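(* The equivalence group $G^\sim_{\bar{\mathcal K}'}$ of the class $\bar{\mathcal K}'$ of Kolmogorov equations with time-independent coefficients, $u_t=A(x)u_{xx}+B(x)u_x$ with $A\neq0$, is constituted by the point transformations of the form \[ \tilde t=c_1t+c_2,\quad\tilde x=X(x),\quad\tilde u=c_3u+c_4,\quad\tilde A=\frac{X_x^2}{c_1}A,\quad\tilde B=\frac{X_x}{c_1}B+\frac{X_{xx}}{c_1}A, \] where $X$ is an arbitrary function of $x$ with $X_x\neq0$ and $c_1,\dots,c_4$ are arbitrary constants with $c_1c_3\neq0$.
   Context: Everything is real, smooth and local; $f\neq0$ for a function means that it vanishes nowhere on its domain. The arbitrary elements of the class are the smooth functions $A$ and $B$ of $x$ with $A\neq0$, regarded as coordinates when working with equivalence transformations. The (usual) equivalence (pseudo)group of the class consists of the point transformations (local diffeomorphisms) in the space with coordinates $(t,x,u_{(2)},A,B)$, where $u_{(2)}$ denotes $u$ and its derivatives up to order two, that are projectable to the spaces of $(t,x,u)$ and of $(t,x,u_{(2)})$, are consistent with the contact structure of the second-order jet space (so their components for derivatives are obtained by standard prolongation and are not listed), and map every equation of the class to an equation of the class (with the transformed arbitrary elements) for any values of the arbitrary elements. *)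

theory Defs
  imports "HOL-Analysis.Analysis"
begin

section \<open>Smooth maps between open sets\<close>

text \<open>Meaningful for open \<open>S\<close> only; the derivative is taken in the full neighbourhood filter.\<close>

primrec Ck_on :: "nat \<Rightarrow> 'a set \<Rightarrow> ('a::real_normed_vector \<Rightarrow> 'b::real_normed_vector) \<Rightarrow> bool" where
  "Ck_on 0 S f \<longleftrightarrow> continuous_on S f"
| "Ck_on (Suc k) S f \<longleftrightarrow>
     (\<forall>x\<in>S. f differentiable (at x)) \<and>
     (\<forall>v. Ck_on k S (\<lambda>x. frechet_derivative f (at x) v))"

definition smooth_on :: "'a set \<Rightarrow> ('a::real_normed_vector \<Rightarrow> 'b::real_normed_vector) \<Rightarrow> bool" where
  "smooth_on S f \<longleftrightarrow> (\<forall>k. Ck_on k S f)"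

definition diffeo_on :: "'a set \<Rightarrow> ('a::real_normed_vector \<Rightarrow> 'a) \<Rightarrow> bool" where
  "diffeo_on D \<Phi> \<longleftrightarrow> open D \<and> open (\<Phi> ` D) \<and> smooth_on D \<Phi> \<and>
     (\<exists>\<Psi>. smooth_on (\<Phi> ` D) \<Psi> \<and> (\<forall>p\<in>D. \<Psi> (\<Phi> p) = p))"


section \<open>The space with coordinates \<open>(t, x, u\<^sub>(\<^sub>2\<^sub>), A, B)\<close>\<close>

text \<open>A point is \<open>((t, x, u), (u\<^sub>t, u\<^sub>x, u\<^sub>t\<^sub>t, u\<^sub>t\<^sub>x, u\<^sub>x\<^sub>x), (A, B))\<close>.\<close>

type_synonym base = "real \<times> real \<times> real"
type_synonym derivs = "real \<times> real \<times> real \<times> real \<times> real"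
type_synonym coeffs = "real \<times> real"
type_synonym espace = "base \<times> derivs \<times> coeffs"

definition base_of :: "espace \<Rightarrow> base" where
  "base_of p = fst p"

definition jet_of :: "espace \<Rightarrow> base \<times> derivs" where
  "jet_of p = (fst p, fst (snd p))"

definition coeffs_of :: "espace \<Rightarrow> coeffs" where
  "coeffs_of p = snd (snd p)"

definition x_of :: "espace \<Rightarrow> real" where
  "x_of p = fst (snd (base_of p))"

text \<open>The equation \<open>u\<^sub>t = A u\<^sub>x\<^sub>x + B u\<^sub>x\<close>, read at a point of the extended space.\<close>

fun on_equation :: "espace \<Rightarrow> bool" where
  "on_equation ((t, x, u), (ut, ux, utt, utx, uxx), (A, B)) \<longleftrightarrow> ut = A * uxx + B * ux"

text \<open>The common kernel, at a point, of the contact forms \<open>du - u\<^sub>t dt - u\<^sub>x dx\<close>,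
  \<open>du\<^sub>t - u\<^sub>t\<^sub>t dt - u\<^sub>t\<^sub>x dx\<close> and \<open>du\<^sub>x - u\<^sub>t\<^sub>x dt - u\<^sub>x\<^sub>x dx\<close> of the second-order jet space,
  pulled back to the extended space; the second argument is a tangent vector.\<close>

fun contact_vector :: "espace \<Rightarrow> espace \<Rightarrow> bool" where
  "contact_vector ((t, x, u), (ut, ux, utt, utx, uxx), (A, B))
                  ((dt, dx, du), (dut, dux, dutt, dutx, duxx), (dA, dB)) \<longleftrightarrow>
     du = ut * dt + ux * dx \<and> dut = utt * dt + utx * dx \<and> dux = utx * dt + uxx * dx"

definition preserves_contact :: "espace set \<Rightarrow> (espace \<Rightarrow> espace) \<Rightarrow> bool" where
  "preserves_contact D \<Phi> \<longleftrightarrow>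
     (\<forall>p\<in>D. \<forall>v. contact_vector p v \<longrightarrow> contact_vector (\<Phi> p) (frechet_derivative \<Phi> (at p) v))"

definition projectable :: "espace set \<Rightarrow> (espace \<Rightarrow> espace) \<Rightarrow> (espace \<Rightarrow> 'c) \<Rightarrow> bool" where
  "projectable D \<Phi> \<pi> \<longleftrightarrow> (\<forall>p\<in>D. \<forall>q\<in>D. \<pi> p = \<pi> q \<longrightarrow> \<pi> (\<Phi> p) = \<pi> (\<Phi> q))"


section \<open>The class and its equivalence pseudogroup\<close>

text \<open>The values of the arbitrary elements: smooth functions of \<open>x\<close>, defined locally.\<close>

definition arbitrary_elements :: "real set \<Rightarrow> (real \<Rightarrow> real) \<Rightarrow> (real \<Rightarrow> real) \<Rightarrow> bool" where
  "arbitrary_elements J A B \<longleftrightarrow>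
     open J \<and> smooth_on J A \<and> smooth_on J B \<and> (\<forall>x\<in>J. A x \<noteq> 0)"

text \<open>For fixed \<open>(A, B)\<close> the map acts on jets through the graph of \<open>(A, B)\<close>. The transformed
  arbitrary elements must again be functions of the transformed \<open>x\<close> alone on the whole image of
  the graph, not only on the image of the equation.\<close>

definition maps_class_to_class :: "espace set \<Rightarrow> (espace \<Rightarrow> espace) \<Rightarrow> bool" where
  "maps_class_to_class D \<Phi> \<longleftrightarrow>
     (\<forall>J A B. arbitrary_elements J A B \<longrightarrow>
        (\<exists>J' A' B'. arbitrary_elements J' A' B' \<and>
           (\<forall>p\<in>D. x_of p \<in> J \<and> coeffs_of p = (A (x_of p), B (x_of p)) \<longrightarrow>
              x_of (\<Phi> p) \<in> J' \<and>
              coeffs_of (\<Phi> p) = (A' (x_of (\<Phi> p)), B' (x_of (\<Phi> p))) \<and>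
              (on_equation p \<longleftrightarrow> on_equation (\<Phi> p)))))"

text \<open>The domains of local transformations. The connectedness conditions on the projection to the
  \<open>(t, x, u)\<close>-space hold, e.g., for convex projections; they allow a function locally depending
  on \<open>x\<close> alone to be a function of \<open>x\<close>, and a locally constant one to be a constant.
  By the last condition, every equation of the class that has jets with given
  \<open>(t, x, u, A, B)\<close> in the domain has a jet there satisfying it: a transformation of jets that avoid
  the equations is not restricted by mapping equations to equations. All these conditions hold for
  arbitrarily small neighbourhoods of any point that satisfies the equation and has \<open>A \<noteq> 0\<close>,
  and for the set of all points with \<open>A \<noteq> 0\<close>.\<close>

definition local_domain :: "espace set \<Rightarrow> bool" where
  "local_domain D \<longleftrightarrow>
     open D \<and>
     (\<forall>p\<in>D. fst (coeffs_of p) \<noteq> 0) \<and>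
     connected (base_of ` D) \<and>
     (\<forall>x. connected {(t, u). (t, x, u) \<in> base_of ` D}) \<and>
     (\<forall>p\<in>D. \<exists>q\<in>D. base_of q = base_of p \<and> coeffs_of q = coeffs_of p \<and> on_equation q)"

text \<open>Only the values of \<open>\<Phi>\<close> on \<open>D\<close> matter in a pair \<open>(D, \<Phi>)\<close>.\<close>

definition equivalence_pseudogroup :: "(espace set \<times> (espace \<Rightarrow> espace)) set" where
  "equivalence_pseudogroup =
     {(D, \<Phi>). local_domain D \<and> diffeo_on D \<Phi> \<and>
        projectable D \<Phi> base_of \<and> projectable D \<Phi> jet_of \<and>
        preserves_contact D \<Phi> \<and> maps_class_to_class D \<Phi>}"

end

theory Submission
  imports Defs
begin

text \<open>
  Write \<open>T, X, U\<close> for the base components of a transformation. Transformed coefficients depend on the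
  transformed \<open>x\<close> alone along the graph of every pair \<open>(A, B)\<close>, and the slopes of \<open>A\<close> and \<open>B\<close> at a
  point are arbitrary. Hence a tangent vector killed by \<open>dX\<close> but moving \<open>x\<close> would force the transformed
  coefficients to be independent of \<open>A\<close>, against invertibility; so \<open>X\<close> is a function of \<open>x\<close> only.

  By the contact condition the transformed \<open>u\<^sub>x\<^sub>x\<close> depends on \<open>u\<^sub>t\<^sub>t\<close> unless \<open>T\<^sub>x + u\<^sub>x T\<^sub>u = 0\<close>, while
  \<open>u\<^sub>t\<^sub>t\<close> is free on the equation; hence \<open>T\<^sub>x = T\<^sub>u = 0\<close>. The transformed equation is then polynomial in the
  free coordinates \<open>u\<^sub>x\<close> and \<open>u\<^sub>x\<^sub>x\<close>. Its coefficients give \<open>U\<^sub>u\<^sub>u = 0\<close>, the transformed coefficients, and,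
  since \<open>B\<close> is free too, \<open>U\<^sub>x = 0\<close> and then \<open>U\<^sub>t = 0\<close>. Finally the transformed \<open>A\<close> equals
  \<open>X\<^sub>x\<^sup>2 A / T\<^sub>t\<close> and may not depend on \<open>t\<close>, so \<open>T\<^sub>t\<close> is constant.
\<close>

section \<open>Calculus of smooth maps\<close>

text \<open>The transformed equation says something only at jets lying on the original equation,
  whereas the claim concerns all of \<open>D\<close>. The gap is bridged because the quantities
  sought depend on the base point alone, or on the base point and the coefficients, and every point
  of \<open>D\<close> shares these data with a point on the equation; conclusions are drawn there
  and then transferred. Passing from vanishing derivatives to constants also needs care, as
  \<open>D\<close> itself may be disconnected: functions are pushed down to the base space or to its
  sections at fixed \<open>x\<close>, where connectedness is available. In the converse direction an
  explicit left inverse gives injectivity, invariance of domain makes the image open, and the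
  smoothness of the inverse is read off its formula.\<close>

lemma Ck_on_cong:
  assumes "open S" "\<And>x. x \<in> S \<Longrightarrow> f x = g x"
  shows "Ck_on k S f \<longleftrightarrow> Ck_on k S g"
  using assms(2)
proof (induction k arbitrary: f g)
  case 0
  then show ?case by (simp cong: continuous_on_cong)
next
  case (Suc k)
  have main: "Ck_on (Suc k) S g" if "Ck_on (Suc k) S f" "\<And>x. x \<in> S \<Longrightarrow> f x = g x" for f g :: "'a \<Rightarrow> 'b"
  proof -
    have eq: "frechet_derivative f (at x) = frechet_derivative g (at x)" if "x \<in> S" for x
      using \<open>Ck_on (Suc k) S f\<close> \<open>open S\<close> that \<open>\<And>x. x \<in> S \<Longrightarrow> f x = g x\<close>
      by (intro frechet_derivative_transform_within_open[of _ _ S]) auto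
    moreover have "g differentiable at x" if "x \<in> S" for x
      using \<open>Ck_on (Suc k) S f\<close> \<open>open S\<close> that \<open>\<And>x. x \<in> S \<Longrightarrow> f x = g x\<close>
      unfolding differentiable_def Ck_on.simps by (metis has_derivative_transform_within_open)
    moreover have "Ck_on k S (\<lambda>x. frechet_derivative g (at x) v)" for v
      using Suc.IH[of "\<lambda>x. frechet_derivative f (at x) v" "\<lambda>x. frechet_derivative g (at x) v"]
        eq \<open>Ck_on (Suc k) S f\<close> by simp
    ultimately show ?thesis by simp
  qed
  show ?case using main[of f g] main[of g f] Suc.prems by (auto simp del: Ck_on.simps)
qed

text \<open>\<open>Ck_on\<close> speaks of \<open>frechet_derivative\<close>, while calculus rules
  produce explicit derivatives; uniqueness of the derivative identifies the two on \<open>S\<close>,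
  and \<open>Ck_on_cong\<close> carries the regularity over.\<close>

lemma Ck_on_SucI:
  assumes "open S" "\<And>x. x \<in> S \<Longrightarrow> (f has_derivative f' x) (at x)"
    and "\<And>v. Ck_on k S (\<lambda>x. f' x v)"
  shows "Ck_on (Suc k) S f"
proof -
  have "frechet_derivative f (at x) = f' x" if "x \<in> S" for x
    using assms(2)[OF that] frechet_derivative_at by metis
  then have "Ck_on k S (\<lambda>x. frechet_derivative f (at x) v)" for v
    using assms(3)[of v] Ck_on_cong[OF \<open>open S\<close>, of "\<lambda>x. frechet_derivative f (at x) v" "\<lambda>x. f' x v" k]
    by simp
  then show ?thesis
    using assms(2) by (auto simp: differentiable_def)
qed

lemma Ck_on_has_derivative:
  assumes "Ck_on (Suc k) S f" "x \<in> S"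
  shows "(f has_derivative frechet_derivative f (at x)) (at x)"
  using assms by (simp add: frechet_derivative_works[symmetric])

lemma Ck_on_SucD: "Ck_on (Suc k) S f \<Longrightarrow> Ck_on k S f"
proof (induction k arbitrary: f)
  case 0
  then show ?case
    by (auto intro!: continuous_at_imp_continuous_on differentiable_imp_continuous_within)
next
  case (Suc k)
  then show ?case by (metis Ck_on.simps(2))
qed

lemma Ck_on_subset: "Ck_on k S f \<Longrightarrow> T \<subseteq> S \<Longrightarrow> Ck_on k T f"
  by (induction k arbitrary: f) (auto intro: continuous_on_subset)

text \<open>Serves functions whose smoothness is visible only near each point, such as the function
  of \<open>x\<close> extracted from a component of the transformation.\<close>

lemma Ck_on_locally:
  assumes "\<And>x. x \<in> S \<Longrightarrow> \<exists>N. open N \<and> x \<in> N \<and> Ck_on k N f"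
  shows "Ck_on k S f"
  using assms
proof (induction k arbitrary: f)
  case 0
  show ?case
  proof (simp, intro continuous_at_imp_continuous_on ballI)
    fix x assume "x \<in> S"
    with 0 obtain N where "open N" "x \<in> N" "continuous_on N f" by auto
    then show "isCont f x" by (simp add: continuous_on_eq_continuous_at)
  qed
next
  case (Suc k)
  have "f differentiable at x" if "x \<in> S" for x
    using Suc.prems[OF that] by auto
  moreover have "Ck_on k S (\<lambda>x. frechet_derivative f (at x) v)" for v
  proof (rule Suc.IH)
    fix x assume "x \<in> S"
    with Suc.prems obtain N where "open N" "x \<in> N" "Ck_on (Suc k) N f" by blast
    then show "\<exists>N. open N \<and> x \<in> N \<and> Ck_on k N (\<lambda>x. frechet_derivative f (at x) v)"
      by auto
  qed
  ultimately show ?case by simp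
qed

lemma Ck_on_const: "open S \<Longrightarrow> Ck_on k S (\<lambda>x. c)"
  by (induction k arbitrary: c) auto

lemma Ck_on_bounded_linear:
  assumes "bounded_linear f" "open S" shows "Ck_on k S f"
proof (cases k)
  case 0
  then show ?thesis using assms by (simp add: linear_continuous_on)
next
  case (Suc m)
  then show ?thesis
    unfolding Suc using assms
    by (intro Ck_on_SucI[where f'="\<lambda>_. f"] Ck_on_const bounded_linear_imp_has_derivative)
qed

lemma Ck_on_Pair:
  assumes "open S" "Ck_on k S f" "Ck_on k S g" shows "Ck_on k S (\<lambda>x. (f x, g x))"
  using assms(2,3)
proof (induction k arbitrary: f g)
  case 0 then show ?case by (simp add: continuous_on_Pair)
next
  case (Suc k)
  show ?case
    by (rule Ck_on_SucI[OF \<open>open S\<close> has_derivative_Pair[OF Ck_on_has_derivative[OF Suc.prems(1)]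
            Ck_on_has_derivative[OF Suc.prems(2)]]])
       (use Suc in auto)
qed

lemma Ck_on_add:
  assumes "open S" "Ck_on k S f" "Ck_on k S g" shows "Ck_on k S (\<lambda>x. f x + g x)"
  using assms(2,3)
proof (induction k arbitrary: f g)
  case 0 then show ?case by (simp add: continuous_on_add)
next
  case (Suc k)
  show ?case
    by (rule Ck_on_SucI[OF \<open>open S\<close> has_derivative_add[OF Ck_on_has_derivative[OF Suc.prems(1)]
            Ck_on_has_derivative[OF Suc.prems(2)]]])
       (use Suc in auto)
qed

lemma Ck_on_sum:
  assumes "open S" "\<And>i. i \<in> I \<Longrightarrow> Ck_on k S (f i)" shows "Ck_on k S (\<lambda>x. \<Sum>i\<in>I. f i x)"
  using assms(2)
  by (induction I rule: infinite_finite_induct) (auto intro: Ck_on_const Ck_on_add assms(1))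

lemma Ck_on_bilinear:
  assumes "bounded_bilinear h" "open S" "Ck_on k S f" "Ck_on k S g"
  shows "Ck_on k S (\<lambda>x. h (f x) (g x))"
  using assms(3,4)
proof (induction k arbitrary: f g)
  case 0 then show ?case using assms(1) by (simp add: bounded_bilinear.continuous_on)
next
  case (Suc k)
  have "Ck_on k S f" "Ck_on k S g" using Suc.prems by (auto intro: Ck_on_SucD)
  then show ?case
    by (intro Ck_on_SucI[OF \<open>open S\<close> bounded_bilinear.FDERIV[OF assms(1)
            Ck_on_has_derivative[OF Suc.prems(1)] Ck_on_has_derivative[OF Suc.prems(2)]]])
       (use Suc in \<open>auto intro!: Ck_on_add assms(2)\<close>)
qed

text \<open>The chain rule applies the derivative of \<open>g\<close> to a direction varying with
  the point, whereas \<open>Ck_on\<close> controls it in fixed directions. A finite basis of the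
  intermediate space turns the expression into a finite sum of products.\<close>

lemma Ck_on_compose:
  fixes f :: "'a::real_normed_vector \<Rightarrow> 'b::euclidean_space" and g :: "'b \<Rightarrow> 'c::real_normed_vector"
  assumes "open S" "open T" "f ` S \<subseteq> T" "Ck_on k S f" "Ck_on k T g"
  shows "Ck_on k S (\<lambda>x. g (f x))"
  using assms(4,5)
proof (induction k arbitrary: g)
  case 0 then show ?case using assms(3) by (auto intro: continuous_on_compose2)
next
  case (Suc k)
  let ?f = "\<lambda>x. frechet_derivative f (at x)" and ?g = "\<lambda>y. frechet_derivative g (at y)"
  show ?case
  proof (rule Ck_on_SucI[OF \<open>open S\<close>])
    fix x assume "x \<in> S"
    then have "(g has_derivative ?g (f x)) (at (f x))"
      using Suc.prems assms(3) by (intro Ck_on_has_derivative) auto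
    moreover have "(f has_derivative ?f x) (at x)"
      using Suc.prems \<open>x \<in> S\<close> by (intro Ck_on_has_derivative)
    ultimately show "((\<lambda>x. g (f x)) has_derivative (\<lambda>v. ?g (f x) (?f x v))) (at x)"
      using has_derivative_compose by blast
  next
    fix v
    have "?g (f x) (?f x v) = (\<Sum>i\<in>Basis. (?f x v \<bullet> i) *\<^sub>R ?g (f x) i)" if "x \<in> S" for x
    proof -
      have lin: "linear (?g (f x))"
        using Suc.prems assms(3) that by (intro linear_frechet_derivative) auto
      have "?g (f x) (?f x v) = ?g (f x) (\<Sum>i\<in>Basis. (?f x v \<bullet> i) *\<^sub>R i)"
        by (simp add: euclidean_representation)
      then show ?thesis by (simp add: linear_sum[OF lin] linear_scale[OF lin])
    qed
    moreover have "Ck_on k S (\<lambda>x. \<Sum>i\<in>Basis. (?f x v \<bullet> i) *\<^sub>R ?g (f x) i)"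
    proof (intro Ck_on_sum Ck_on_bilinear[OF bounded_bilinear_scaleR] \<open>open S\<close>)
      fix i :: 'b
      show "Ck_on k S (\<lambda>x. ?f x v \<bullet> i)"
        using Suc.prems
        by (intro Ck_on_bilinear[OF bounded_bilinear_inner] Ck_on_const \<open>open S\<close>) auto
      show "Ck_on k S (\<lambda>x. ?g (f x) i)"
        using Suc.prems Ck_on_SucD[of k S f] by (intro Suc.IH) auto
    qed
    ultimately show "Ck_on k S (\<lambda>x. ?g (f x) (?f x v))"
      by (simp add: Ck_on_cong[OF \<open>open S\<close>, of "\<lambda>x. ?g (f x) (?f x v)"])
  qed
qed

text \<open>The derivative of the reciprocal is a product of the reciprocal itself and the
  derivative of \<open>f\<close>, so each order of regularity yields the next.\<close>

lemma Ck_on_inverse: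
  fixes f :: "'a::real_normed_vector \<Rightarrow> real"
  assumes "open S" "Ck_on k S f" "\<And>x. x \<in> S \<Longrightarrow> f x \<noteq> 0"
  shows "Ck_on k S (\<lambda>x. inverse (f x))"
  using assms(2)
proof (induction k)
  case 0 then show ?case using assms(3) by (auto intro: continuous_on_inverse)
next
  case (Suc k)
  have IH: "Ck_on k S (\<lambda>x. inverse (f x))" using Suc Ck_on_SucD by blast
  show ?case
  proof (rule Ck_on_SucI[OF \<open>open S\<close>])
    fix x assume "x \<in> S"
    show "((\<lambda>x. inverse (f x)) has_derivative
       (\<lambda>v. - 1 * (inverse (f x) * frechet_derivative f (at x) v * inverse (f x)))) (at x)"
      using Deriv.has_derivative_inverse[OF assms(3)[OF \<open>x \<in> S\<close>] Ck_on_has_derivative[OF Suc.prems \<open>x \<in> S\<close>]]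
      by simp
  next
    fix v
    show "Ck_on k S (\<lambda>x. - 1 * (inverse (f x) * frechet_derivative f (at x) v * inverse (f x)))"
      using Suc.prems IH
      by (intro Ck_on_bilinear[OF bounded_bilinear_mult] Ck_on_const \<open>open S\<close>) auto
  qed
qed

section \<open>Closure rules for smooth maps\<close>

named_theorems smooth_intros

lemma smooth_on_cong:
  "open S \<Longrightarrow> (\<And>x. x \<in> S \<Longrightarrow> f x = g x) \<Longrightarrow> smooth_on S f \<longleftrightarrow> smooth_on S g"
  using Ck_on_cong unfolding smooth_on_def by blast

lemma smooth_on_subset: "smooth_on S f \<Longrightarrow> T \<subseteq> S \<Longrightarrow> smooth_on T f"
  unfolding smooth_on_def using Ck_on_subset by blast

lemma smooth_on_locally:
  assumes "\<And>x. x \<in> S \<Longrightarrow> \<exists>N. open N \<and> x \<in> N \<and> smooth_on N f"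
  shows "smooth_on S f"
  unfolding smooth_on_def
proof
  fix k show "Ck_on k S f"
    by (rule Ck_on_locally) (use assms in \<open>auto simp: smooth_on_def\<close>)
qed

lemma smooth_on_const [smooth_intros]: "open S \<Longrightarrow> smooth_on S (\<lambda>x. c)"
  unfolding smooth_on_def using Ck_on_const by blast

lemma smooth_on_bounded_linear: "bounded_linear f \<Longrightarrow> open S \<Longrightarrow> smooth_on S f"
  unfolding smooth_on_def using Ck_on_bounded_linear by blast

lemma smooth_on_Pair [smooth_intros]:
  "open S \<Longrightarrow> smooth_on S f \<Longrightarrow> smooth_on S g \<Longrightarrow> smooth_on S (\<lambda>x. (f x, g x))"
  unfolding smooth_on_def using Ck_on_Pair by blast

lemma smooth_on_add [smooth_intros]:
  "open S \<Longrightarrow> smooth_on S f \<Longrightarrow> smooth_on S g \<Longrightarrow> smooth_on S (\<lambda>x. f x + g x)"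
  unfolding smooth_on_def using Ck_on_add by blast

lemma smooth_on_mult [smooth_intros]:
  fixes f g :: "'a::real_normed_vector \<Rightarrow> real"
  shows "open S \<Longrightarrow> smooth_on S f \<Longrightarrow> smooth_on S g \<Longrightarrow> smooth_on S (\<lambda>x. f x * g x)"
  unfolding smooth_on_def using Ck_on_bilinear[OF bounded_bilinear_mult] by blast

lemma smooth_on_diff [smooth_intros]:
  fixes f g :: "'a::real_normed_vector \<Rightarrow> real"
  assumes "open S" "smooth_on S f" "smooth_on S g"
  shows "smooth_on S (\<lambda>x. f x - g x)"
proof -
  have "smooth_on S (\<lambda>x. f x + (- 1) * g x)"
    using assms by (intro smooth_intros)
  then show ?thesis by simp
qed

lemma smooth_on_power [smooth_intros]:
  fixes f :: "'a::real_normed_vector \<Rightarrow> real"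
  assumes "open S" "smooth_on S f"
  shows "smooth_on S (\<lambda>x. f x ^ n)"
  by (induction n) (auto intro!: smooth_intros assms)

lemma smooth_on_divide [smooth_intros]:
  fixes f g :: "'a::real_normed_vector \<Rightarrow> real"
  assumes "open S" "smooth_on S f" "smooth_on S g" "\<And>x. x \<in> S \<Longrightarrow> g x \<noteq> 0"
  shows "smooth_on S (\<lambda>x. f x / g x)"
  using assms Ck_on_inverse[OF \<open>open S\<close>, of _ g]
  unfolding divide_inverse by (intro smooth_on_mult) (auto simp: smooth_on_def)

lemma smooth_on_compose:
  fixes f :: "'a::real_normed_vector \<Rightarrow> 'b::euclidean_space" and g :: "'b \<Rightarrow> 'c::real_normed_vector"
  assumes "smooth_on T g" "open S" "open T" "f ` S \<subseteq> T" "smooth_on S f"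
  shows "smooth_on S (\<lambda>x. g (f x))"
  using assms Ck_on_compose unfolding smooth_on_def by blast

lemma smooth_on_fst [smooth_intros]:
  fixes f :: "'a::real_normed_vector \<Rightarrow> 'b::euclidean_space \<times> 'c::euclidean_space"
  assumes "open S" "smooth_on S f"
  shows "smooth_on S (\<lambda>x. fst (f x))"
  using assms smooth_on_compose[OF smooth_on_bounded_linear[OF bounded_linear_fst open_UNIV]] by auto

lemma smooth_on_snd [smooth_intros]:
  fixes f :: "'a::real_normed_vector \<Rightarrow> 'b::euclidean_space \<times> 'c::euclidean_space"
  assumes "open S" "smooth_on S f"
  shows "smooth_on S (\<lambda>x. snd (f x))"
  using assms smooth_on_compose[OF smooth_on_bounded_linear[OF bounded_linear_snd open_UNIV]] by auto

lemma smooth_on_ident [smooth_intros]: "open S \<Longrightarrow> smooth_on S (\<lambda>x. x)"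
  by (intro smooth_on_bounded_linear bounded_linear_ident)

lemma smooth_on_has_derivative:
  "smooth_on S f \<Longrightarrow> x \<in> S \<Longrightarrow> (f has_derivative frechet_derivative f (at x)) (at x)"
  unfolding smooth_on_def by (blast intro: Ck_on_has_derivative)

lemma smooth_on_frechet_derivative:
  "smooth_on S f \<Longrightarrow> smooth_on S (\<lambda>x. frechet_derivative f (at x) v)"
  unfolding smooth_on_def by (metis Ck_on.simps(2))

lemma smooth_on_imp_continuous_on: "smooth_on S f \<Longrightarrow> continuous_on S f"
  unfolding smooth_on_def by (metis Ck_on.simps(1))

section \<open>Functions of one variable and their inverses\<close>

lemma smooth_on_DERIV:
  fixes f :: "real \<Rightarrow> real"
  assumes "smooth_on S f" "x \<in> S"
  shows "(f has_real_derivative deriv f x) (at x)"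
proof -
  have "f differentiable at x"
    using smooth_on_has_derivative[OF assms] by (auto simp: differentiable_def)
  then show ?thesis by (simp add: DERIV_deriv_iff_real_differentiable)
qed

lemma smooth_on_deriv:
  fixes f :: "real \<Rightarrow> real"
  assumes "open S" "smooth_on S f"
  shows "smooth_on S (deriv f)"
proof -
  have "frechet_derivative f (at x) 1 = deriv f x" if "x \<in> S" for x
    using frechet_derivative_at[OF has_field_derivative_imp_has_derivative[OF smooth_on_DERIV[OF assms(2) that]]]
    by (metis mult.right_neutral)
  then show ?thesis
    using smooth_on_frechet_derivative[OF assms(2), of 1]
      smooth_on_cong[OF assms(1), of "\<lambda>x. frechet_derivative f (at x) 1" "deriv f"] by simp
qed

text \<open>The derivative of the inverse is the reciprocal of \<open>deriv f\<close> composed with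
  the inverse itself, so continuity, a consequence of invariance of domain, bootstraps to every
  order. The left inverse is part of the data because \<open>S\<close> may be disconnected, so that
  a nonzero derivative alone does not give injectivity.\<close>

lemma smooth_on_inverse_function:
  fixes f g :: "real \<Rightarrow> real"
  assumes S: "open S" and f: "smooth_on S f" and f': "\<And>x. x \<in> S \<Longrightarrow> deriv f x \<noteq> 0"
    and gf: "\<And>x. x \<in> S \<Longrightarrow> g (f x) = x"
  shows "open (f ` S)" "smooth_on (f ` S) g"
proof -
  have cont: "continuous_on S f" using f by (rule smooth_on_imp_continuous_on)
  show op: "open (f ` S)"
    using invariance_of_domain[OF cont S] gf by (metis inj_on_inverseI)
  have contg: "continuous_on (f ` S) g"
    using continuous_on_inverse_open[OF S cont] gf by simp
  have der: "(g has_derivative (\<lambda>v. v * inverse (deriv f (g y)))) (at y)" if "y \<in> f ` S" for y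
  proof (rule has_derivative_inverse_basic[of f "\<lambda>v. v * deriv f (g y)"])
    have "g y \<in> S" using that gf by auto
    then show "(f has_derivative (\<lambda>v. v * deriv f (g y))) (at (g y))"
      using smooth_on_DERIV[OF f] has_field_derivative_imp_has_derivative by (metis (no_types, lifting) ext mult.commute)
    show "bounded_linear (\<lambda>v. v * inverse (deriv f (g y)))" by (rule bounded_linear_mult_left)
    show "(\<lambda>v. v * inverse (deriv f (g y))) \<circ> (\<lambda>v. v * deriv f (g y)) = id"
      using f'[OF \<open>g y \<in> S\<close>] by (auto simp: fun_eq_iff)
    show "continuous (at y) g" using contg op that continuous_on_eq_continuous_at by blast
    show "open (f ` S)" "y \<in> f ` S" by fact+
    show "\<And>z. z \<in> f ` S \<Longrightarrow> f (g z) = z" using gf by auto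
  qed
  have "Ck_on k (f ` S) g" for k
  proof (induction k)
    case 0 then show ?case using contg by simp
  next
    case (Suc k)
    have im: "g ` f ` S \<subseteq> S" using gf by auto
    show ?case
      using smooth_on_deriv[OF S f] f' gf
      by (intro Ck_on_SucI[OF op der] Ck_on_bilinear[OF bounded_bilinear_mult] Ck_on_inverse op Ck_on_const
          Ck_on_compose[OF op S im Suc]) (auto simp: smooth_on_def)
  qed
  then show "smooth_on (f ` S) g" by (simp add: smooth_on_def)
qed

section \<open>Transformations of the stated form\<close>

text \<open>By Rolle's theorem a repeated value would produce a zero of the derivative in between.
  Connectedness of the \<open>x\<close>-projection of \<open>D\<close> thus supplies the inverse of
  \<open>X\<close>.\<close>

lemma inj_on_deriv_nonzero:
  fixes f :: "real \<Rightarrow> real"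
  assumes "connected S" "smooth_on S f" "\<And>x. x \<in> S \<Longrightarrow> deriv f x \<noteq> 0"
  shows "inj_on f S"
proof (rule linorder_inj_onI)
  fix a b assume "a < b" and ab: "a \<in> S" "b \<in> S"
  have sub: "{a..b} \<subseteq> S" using assms(1) ab by (simp add: connected_contains_Icc)
  show "f a \<noteq> f b"
  proof
    assume "f a = f b"
    moreover have "continuous_on {a..b} f"
      using assms(2) sub continuous_on_subset smooth_on_imp_continuous_on by blast
    moreover have "f differentiable (at z)" if "a < z" "z < b" for z
      using smooth_on_DERIV[OF assms(2)] sub that
      by (metis atLeastAtMost_iff less_eq_real_def real_differentiable_def subsetD)
    ultimately obtain z where z: "a < z" "z < b" "DERIV f z :> 0"
      using Rolle[OF \<open>a < b\<close>] by blast
    then have "z \<in> S" using sub by auto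
    then show False using assms(3) z(3) DERIV_imp_deriv by blast
  qed
qed auto

text \<open>Coordinate projections are surjective linear maps, hence open; connectedness of the
  \<open>x\<close>-projection is inherited from that of the base.\<close>

lemma local_domain_projections:
  assumes "local_domain D"
  shows "open D" "open (base_of ` D)" "open (x_of ` D)" "connected (base_of ` D)" "connected (x_of ` D)"
proof -
  show D: "open D" and con: "connected (base_of ` D)" using assms by (auto simp: local_domain_def)
  have "linear base_of" by (auto simp: base_of_def[abs_def] linear_fst)
  moreover have "surj base_of" by (rule surjI[of _ "\<lambda>b. (b, undefined)"]) (simp add: base_of_def)
  ultimately show "open (base_of ` D)" using D open_surjective_linear_image by blast
  have "linear x_of" by (auto simp: x_of_def base_of_def intro!: linearI)
  moreover have "surj x_of" by (rule surjI[of _ "\<lambda>x. ((0, x, 0), 0)"]) (simp add: x_of_def base_of_def)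
  ultimately show "open (x_of ` D)" using D open_surjective_linear_image by blast
  have "x_of ` D = (\<lambda>b. fst (snd b)) ` base_of ` D" by (auto simp: x_of_def image_comp)
  then show "connected (x_of ` D)"
    using con by (auto intro!: connected_continuous_image continuous_intros)
qed

text \<open>The derivative components are the standard prolongation: every new derivative is a total
  derivative of a lower one, divided by \<open>c1\<close> for \<open>t\<close> and by
  \<open>X_x\<close> for \<open>x\<close>. The \<open>u_x\<close> term in the last of them comes
  from differentiating the factor \<open>c3 / X_x\<close>.\<close>

fun prolonged_transf :: "real \<Rightarrow> real \<Rightarrow> real \<Rightarrow> real \<Rightarrow> (real \<Rightarrow> real) \<Rightarrow> espace \<Rightarrow> espace" where
  "prolonged_transf c1 c2 c3 c4 X ((t, x, u), (ut, ux, utt, utx, uxx), (A, B)) =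
     ((c1 * t + c2, X x, c3 * u + c4),
      (c3 / c1 * ut,
       c3 / deriv X x * ux,
       c3 / c1^2 * utt,
       c3 / (c1 * deriv X x) * utx,
       c3 / (deriv X x)^2 * uxx - c3 * deriv (deriv X) x / (deriv X x)^3 * ux),
      ((deriv X x)^2 / c1 * A,
       deriv X x / c1 * B + deriv (deriv X) x / c1 * A))"

text \<open>Obtained by solving the components of \<open>prolonged_transf\<close> one after another.
  Writing it through derivatives of \<open>X\<close> at \<open>Y y\<close> reduces its smoothness to
  that of \<open>X\<close> and \<open>Y\<close>.\<close>

fun prolonged_inverse :: "real \<Rightarrow> real \<Rightarrow> real \<Rightarrow> real \<Rightarrow> (real \<Rightarrow> real) \<Rightarrow> (real \<Rightarrow> real) \<Rightarrow> espace \<Rightarrow> espace" where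
  "prolonged_inverse c1 c2 c3 c4 X Y ((t, y, u), (ut, ux, utt, utx, uxx), (A, B)) =
     (((t - c2) / c1, Y y, (u - c4) / c3),
      (c1 / c3 * ut,
       deriv X (Y y) / c3 * ux,
       c1^2 / c3 * utt,
       c1 * deriv X (Y y) / c3 * utx,
       (deriv X (Y y))^2 / c3 * uxx + deriv (deriv X) (Y y) / c3 * ux),
      (c1 / (deriv X (Y y))^2 * A,
       c1 / deriv X (Y y) * B - c1 * deriv (deriv X) (Y y) / (deriv X (Y y))^3 * A))"

lemma prolonged_inverse:
  assumes "c1 * c3 \<noteq> 0" "deriv X (x_of p) \<noteq> 0" "Y (X (x_of p)) = x_of p"
  shows "prolonged_inverse c1 c2 c3 c4 X Y (prolonged_transf c1 c2 c3 c4 X p) = p"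
proof -
  obtain t x u ut ux utt utx uxx A B where p: "p = ((t, x, u), (ut, ux, utt, utx, uxx), (A, B))"
    by (metis surj_pair)
  define d e where "d = deriv X x" and "e = deriv (deriv X) x"
  have "d \<noteq> 0" "c1 \<noteq> 0" "c3 \<noteq> 0" using assms by (auto simp: p x_of_def base_of_def d_def)
  then show ?thesis using assms
    by (simp add: p x_of_def base_of_def d_def[symmetric] e_def[symmetric] field_simps power2_eq_square power3_eq_cube)
qed

text \<open>The \<open>X_xx\<close> terms of the new \<open>u_xx\<close> and of the new
  \<open>B\<close> cancel, so the residual of the equation is merely multiplied by
  \<open>c3 / c1\<close>.\<close>

lemma on_equation_prolonged_transf:
  assumes "c1 * c3 \<noteq> 0" "deriv X (x_of p) \<noteq> 0"
  shows "on_equation (prolonged_transf c1 c2 c3 c4 X p) \<longleftrightarrow> on_equation p"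
proof -
  obtain t x u ut ux utt utx uxx A B where p: "p = ((t, x, u), (ut, ux, utt, utx, uxx), (A, B))"
    by (metis surj_pair)
  define d e where "d = deriv X x" and "e = deriv (deriv X) x"
  have nz: "d \<noteq> 0" "c1 \<noteq> 0" "c3 \<noteq> 0" using assms by (auto simp: p x_of_def base_of_def d_def)
  have "d^2 / c1 * A * (c3 / d^2 * uxx - c3 * e / d^3 * ux) + (d / c1 * B + e / c1 * A) * (c3 / d * ux)
      = c3 / c1 * (A * uxx + B * ux)"
    using nz by (simp add: field_simps power2_eq_square power3_eq_cube)
  then have "on_equation (prolonged_transf c1 c2 c3 c4 X p) \<longleftrightarrow> c3 / c1 * ut = c3 / c1 * (A * uxx + B * ux)"
    by (simp add: p d_def e_def)
  then show ?thesis using nz by (simp add: p)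
qed

section \<open>Sufficiency: maps of the stated form belong to the pseudogroup\<close>

locale prolonged =
  fixes D :: "espace set" and c1 c2 c3 c4 :: real and X :: "real \<Rightarrow> real"
  assumes D: "local_domain D" and nz: "c1 * c3 \<noteq> 0"
    and X: "smooth_on (x_of ` D) X" and X': "\<And>x. x \<in> x_of ` D \<Longrightarrow> deriv X x \<noteq> 0"
begin

abbreviation "\<Phi> \<equiv> prolonged_transf c1 c2 c3 c4 X"

lemmas D_open = local_domain_projections(1)[OF D]
lemmas x_open = local_domain_projections(3)[OF D]

definition "Y = inv_into (x_of ` D) X"

lemma Y: "x \<in> x_of ` D \<Longrightarrow> Y (X x) = x"
  using inj_on_deriv_nonzero[OF local_domain_projections(5)[OF D] X X'] by (simp add: Y_def)

lemma smooth_on_Y: "open (X ` x_of ` D)" "smooth_on (X ` x_of ` D) Y"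
  using smooth_on_inverse_function[OF x_open X X' Y] by auto

lemmas smooth_derivs = smooth_on_deriv[OF x_open X] smooth_on_deriv[OF x_open smooth_on_deriv[OF x_open X]]

lemma smooth_on_x_of:
  assumes "smooth_on (x_of ` D) f" shows "smooth_on D (\<lambda>p. f (fst (snd (fst p))))"
proof (rule smooth_on_compose[OF assms D_open x_open])
  show "smooth_on D (\<lambda>p. fst (snd (fst p)))" by (intro smooth_intros D_open)
qed (auto simp: x_of_def base_of_def)

lemma smooth_on_transf: "smooth_on D \<Phi>"
proof -
  let ?x = "\<lambda>p::espace. fst (snd (fst p))"
  have eq: "\<Phi> = (\<lambda>p.
     ((c1 * fst (fst p) + c2, X (?x p), c3 * snd (snd (fst p)) + c4),
      (c3 / c1 * fst (fst (snd p)),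
       c3 / deriv X (?x p) * fst (snd (fst (snd p))),
       c3 / c1^2 * fst (snd (snd (fst (snd p)))),
       c3 / (c1 * deriv X (?x p)) * fst (snd (snd (snd (fst (snd p))))),
       c3 / (deriv X (?x p))^2 * snd (snd (snd (snd (fst (snd p)))))
         - c3 * deriv (deriv X) (?x p) / (deriv X (?x p))^3 * fst (snd (fst (snd p)))),
      ((deriv X (?x p))^2 / c1 * fst (snd (snd p)),
       deriv X (?x p) / c1 * snd (snd (snd p)) + deriv (deriv X) (?x p) / c1 * fst (snd (snd p)))))"
    by (auto simp: fun_eq_iff)
  have "deriv X (?x p) \<noteq> 0" if "p \<in> D" for p
    using X' that by (auto simp: x_of_def base_of_def)
  then show ?thesis
    unfolding eq using nz
    by (intro smooth_intros D_open smooth_on_x_of X smooth_derivs) auto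
qed

lemma inj_on_transf: "inj_on \<Phi> D"
  by (rule inj_on_inverseI[where g="prolonged_inverse c1 c2 c3 c4 X Y"])
     (use nz X' Y in \<open>auto intro!: prolonged_inverse\<close>)

lemma open_image_transf: "open (\<Phi> ` D)"
  using invariance_of_domain[OF smooth_on_imp_continuous_on[OF smooth_on_transf] D_open inj_on_transf] .

lemma x_of_transf: "x_of (\<Phi> p) = X (x_of p)"
  by (cases p) (auto simp: x_of_def base_of_def)

lemma smooth_on_inverse: "smooth_on (\<Phi> ` D) (prolonged_inverse c1 c2 c3 c4 X Y)"
proof -
  let ?E = "\<Phi> ` D"
  let ?x = "\<lambda>p::espace. fst (snd (fst p))"
  have img: "?x ` ?E \<subseteq> X ` x_of ` D"
  proof -
    have "?x (\<Phi> p) \<in> X ` x_of ` D" if "p \<in> D" for p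
      using x_of_transf[of p] that by (auto simp: x_of_def base_of_def)
    then show ?thesis by blast
  qed
  have sY: "smooth_on ?E (\<lambda>p. Y (?x p))"
    by (rule smooth_on_compose[OF smooth_on_Y(2) open_image_transf smooth_on_Y(1) img])
       (intro smooth_intros open_image_transf)
  have YD: "Y (?x p) \<in> x_of ` D" if "p \<in> ?E" for p
  proof -
    have "?x p \<in> X ` x_of ` D" by (rule subsetD[OF img imageI[OF that]])
    then obtain x where "?x p = X x" "x \<in> x_of ` D" by (rule imageE)
    then show ?thesis using Y by simp
  qed
  then have sc: "smooth_on ?E (\<lambda>p. f (Y (?x p)))" if "smooth_on (x_of ` D) f" for f :: "real \<Rightarrow> real"
    by (intro smooth_on_compose[OF that open_image_transf x_open _ sY] image_subsetI)
  have eq: "prolonged_inverse c1 c2 c3 c4 X Y = (\<lambda>p.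
     (((fst (fst p) - c2) / c1, Y (?x p), (snd (snd (fst p)) - c4) / c3),
      (c1 / c3 * fst (fst (snd p)),
       deriv X (Y (?x p)) / c3 * fst (snd (fst (snd p))),
       c1^2 / c3 * fst (snd (snd (fst (snd p)))),
       c1 * deriv X (Y (?x p)) / c3 * fst (snd (snd (snd (fst (snd p))))),
       (deriv X (Y (?x p)))^2 / c3 * snd (snd (snd (snd (fst (snd p)))))
         + deriv (deriv X) (Y (?x p)) / c3 * fst (snd (fst (snd p)))),
      (c1 / (deriv X (Y (?x p)))^2 * fst (snd (snd p)),
       c1 / deriv X (Y (?x p)) * snd (snd (snd p))
         - c1 * deriv (deriv X) (Y (?x p)) / (deriv X (Y (?x p)))^3 * fst (snd (snd p)))))"
    by (auto simp: fun_eq_iff)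
  show ?thesis
    unfolding eq using nz X' YD
    by (intro smooth_intros open_image_transf sY sc smooth_derivs) auto
qed

lemma diffeo_on_transf: "diffeo_on D \<Phi>"
  unfolding diffeo_on_def
proof (intro conjI exI ballI)
  show "prolonged_inverse c1 c2 c3 c4 X Y (\<Phi> p) = p" if "p \<in> D" for p
    using that X' Y by (intro prolonged_inverse[OF nz]) auto
qed (fact D_open open_image_transf smooth_on_transf smooth_on_inverse)+

text \<open>The contact forms contain no differentials of second-order derivatives or coefficients,
  so five components of the derivative of the map decide the matter.\<close>

lemma preserves_contact_transf: "preserves_contact D \<Phi>"
  unfolding preserves_contact_def
proof (intro ballI allI impI)
  fix p v assume "p \<in> D" and v: "contact_vector p v"
  obtain t x u ut ux utt utx uxx A B where p: "p = ((t, x, u), (ut, ux, utt, utx, uxx), (A, B))"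
    by (metis surj_pair)
  obtain dt dx du dut dux dutt dutx duxx dA dB
    where v_eq: "v = ((dt, dx, du), (dut, dux, dutt, dutx, duxx), (dA, dB))"
    by (metis surj_pair)
  let ?L = "frechet_derivative \<Phi> (at p)"
  have L: "(\<Phi> has_derivative ?L) (at p)" by (rule smooth_on_has_derivative[OF smooth_on_transf \<open>p \<in> D\<close>])
  have xD: "x \<in> x_of ` D" using \<open>p \<in> D\<close> by (force simp: p x_of_def base_of_def image_iff)
  note dX = X'[OF xD]
  have pr: "((\<lambda>q::espace. fst (snd (fst q))) has_derivative (\<lambda>q. fst (snd (fst q)))) (at p)"
    by (auto intro!: derivative_eq_intros)
  have DX: "((\<lambda>q. X (fst (snd (fst q)))) has_derivative (\<lambda>v. fst (snd (fst v)) * deriv X x)) (at p)"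
    by (rule DERIV_compose_FDERIV[OF _ pr]) (use smooth_on_DERIV[OF X xD] p in simp)
  have DX': "((\<lambda>q. deriv X (fst (snd (fst q)))) has_derivative (\<lambda>v. fst (snd (fst v)) * deriv (deriv X) x)) (at p)"
    by (rule DERIV_compose_FDERIV[OF _ pr]) (use smooth_on_DERIV[OF smooth_derivs(1) xD] p in simp)
  have 1: "fst (fst (?L v)) = c1 * dt"
  proof -
    have "((\<lambda>q. c1 * fst (fst q) + c2) has_derivative (\<lambda>v. c1 * fst (fst v))) (at p)"
      by (auto intro!: derivative_eq_intros)
    moreover have "(\<lambda>q. fst (fst (\<Phi> q))) = (\<lambda>q. c1 * fst (fst q) + c2)" by (auto simp: fun_eq_iff)
    ultimately show ?thesis
      using has_derivative_unique[OF has_derivative_fst[OF has_derivative_fst[OF L]]] by (metis v_eq fst_conv)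
  qed
  have 2: "fst (snd (fst (?L v))) = dx * deriv X x"
  proof -
    have "(\<lambda>q. fst (snd (fst (\<Phi> q)))) = (\<lambda>q. X (fst (snd (fst q))))" by (auto simp: fun_eq_iff)
    then show ?thesis
      using has_derivative_unique[OF has_derivative_fst[OF has_derivative_snd[OF has_derivative_fst[OF L]]]] DX
      by (metis v_eq fst_conv snd_conv)
  qed
  have 3: "snd (snd (fst (?L v))) = c3 * du"
  proof -
    have "((\<lambda>q. c3 * snd (snd (fst q)) + c4) has_derivative (\<lambda>v. c3 * snd (snd (fst v)))) (at p)"
      by (auto intro!: derivative_eq_intros)
    moreover have "(\<lambda>q. snd (snd (fst (\<Phi> q)))) = (\<lambda>q. c3 * snd (snd (fst q)) + c4)" by (auto simp: fun_eq_iff)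
    ultimately show ?thesis
      using has_derivative_unique[OF has_derivative_snd[OF has_derivative_snd[OF has_derivative_fst[OF L]]]]
      by (metis v_eq fst_conv snd_conv)
  qed
  have 4: "fst (fst (snd (?L v))) = c3 / c1 * dut"
  proof -
    have "((\<lambda>q. c3 / c1 * fst (fst (snd q))) has_derivative (\<lambda>v. c3 / c1 * fst (fst (snd v)))) (at p)"
      by (rule derivative_eq_intros refl | simp)+
    moreover have "(\<lambda>q. fst (fst (snd (\<Phi> q)))) = (\<lambda>q. c3 / c1 * fst (fst (snd q)))" by (auto simp: fun_eq_iff)
    ultimately show ?thesis
      using has_derivative_unique[OF has_derivative_fst[OF has_derivative_fst[OF has_derivative_snd[OF L]]]]
      by (metis v_eq fst_conv snd_conv)
  qed
  have 5: "fst (snd (fst (snd (?L v)))) = c3 / deriv X x * dux - c3 * deriv (deriv X) x / (deriv X x)^2 * ux * dx"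
  proof -
    have "((\<lambda>q. c3 / deriv X (fst (snd (fst q))) * fst (snd (fst (snd q)))) has_derivative
       (\<lambda>v. c3 / deriv X x * fst (snd (fst (snd v))) - c3 * deriv (deriv X) x / (deriv X x)^2 * ux * fst (snd (fst v)))) (at p)"
    proof -
      have pr': "((\<lambda>q::espace. fst (snd (fst (snd q)))) has_derivative (\<lambda>q. fst (snd (fst (snd q))))) (at p)"
        by (auto intro!: derivative_eq_intros)
      have "deriv X (fst (snd (fst p))) \<noteq> 0" using dX by (simp add: p)
      from has_derivative_mult[OF has_derivative_divide'[OF has_derivative_const[of c3] DX' this] pr']
      show ?thesis
        by (rule has_derivative_eq_rhs) (auto simp: p fun_eq_iff power2_eq_square)
    qed
    moreover have "(\<lambda>q. fst (snd (fst (snd (\<Phi> q))))) = (\<lambda>q. c3 / deriv X (fst (snd (fst q))) * fst (snd (fst (snd q))))"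
      by (auto simp: fun_eq_iff)
    ultimately have "((\<lambda>q. fst (snd (fst (snd (\<Phi> q))))) has_derivative
       (\<lambda>v. c3 / deriv X x * fst (snd (fst (snd v))) - c3 * deriv (deriv X) x / (deriv X x)^2 * ux * fst (snd (fst v)))) (at p)"
      by (simp only:)
    from fun_cong[OF has_derivative_unique[OF has_derivative_fst[OF has_derivative_snd[OF
            has_derivative_fst[OF has_derivative_snd[OF L]]]] this], of v]
    show ?thesis by (simp add: v_eq)
  qed
  obtain Lt Lx Lu Lut Lux Lutt Lutx Luxx LA LB where Lv:
    "?L v = ((Lt, Lx, Lu), (Lut, Lux, Lutt, Lutx, Luxx), (LA, LB))"
    by (metis surj_pair)
  have "Lt = c1 * dt" "Lx = dx * deriv X x" "Lu = c3 * du" "Lut = c3 / c1 * dut"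
    "Lux = c3 / deriv X x * dux - c3 * deriv (deriv X) x / (deriv X x)^2 * ux * dx"
    using 1 2 3 4 5 by (simp_all add: Lv)
  note Ls = this
  have vs: "du = ut * dt + ux * dx" "dut = utt * dt + utx * dx" "dux = utx * dt + uxx * dx"
    using v by (simp_all add: v_eq p)
  define d where "d = deriv X x"
  have "d \<noteq> 0" "c1 \<noteq> 0" using dX nz by (auto simp: d_def)
  then have "Lu = (c3 / c1 * ut) * Lt + (c3 / d * ux) * Lx"
    "Lut = (c3 / c1^2 * utt) * Lt + (c3 / (c1 * d) * utx) * Lx"
    "Lux = (c3 / (c1 * d) * utx) * Lt + (c3 / d^2 * uxx - c3 * deriv (deriv X) x / d^3 * ux) * Lx"
    unfolding Ls vs d_def[symmetric] by (simp_all add: field_simps power2_eq_square power3_eq_cube)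
  then show "contact_vector (\<Phi> p) (?L v)"
    unfolding Lv by (simp add: p d_def)
qed

lemma projectable_transf: "projectable D \<Phi> base_of" "projectable D \<Phi> jet_of"
  by (auto simp: projectable_def base_of_def jet_of_def)

lemma maps_class_to_class_transf: "maps_class_to_class D \<Phi>"
  unfolding maps_class_to_class_def
proof (intro allI impI)
  fix J A B assume *: "arbitrary_elements J A B"
  \<comment> \<open>\<open>X\<close> is smooth and invertible over the projection of
    \<open>D\<close> only, so the coefficients are restricted to that part of \<open>J\<close>
    before being transported along \<open>X\<close>.\<close>
  define I where "I = J \<inter> x_of ` D"
  have I: "open I" "I \<subseteq> x_of ` D" "smooth_on I A" "smooth_on I B" "\<And>x. x \<in> I \<Longrightarrow> A x \<noteq> 0"
    using * x_open by (auto simp: I_def arbitrary_elements_def intro: smooth_on_subset)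
  have XI: "smooth_on I X" "\<And>x. x \<in> I \<Longrightarrow> deriv X x \<noteq> 0" "\<And>x. x \<in> I \<Longrightarrow> Y (X x) = x"
    using X X' Y I(2) by (auto intro: smooth_on_subset)
  note inv = smooth_on_inverse_function[OF I(1) XI]
  have sc: "smooth_on (X ` I) (\<lambda>y. f (Y y))" if "smooth_on I f" for f :: "real \<Rightarrow> real"
    by (rule smooth_on_compose[OF that inv(1) I(1) _ inv(2)]) (use XI(3) in auto)
  define A' where "A' = (\<lambda>y. (deriv X (Y y))^2 / c1 * A (Y y))"
  define B' where "B' = (\<lambda>y. deriv X (Y y) / c1 * B (Y y) + deriv (deriv X) (Y y) / c1 * A (Y y))"
  have "arbitrary_elements (X ` I) A' B'"
    unfolding arbitrary_elements_def A'_def B'_def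
    using nz I XI
    by (intro conjI smooth_intros inv sc smooth_on_deriv) auto
  moreover have "x_of (\<Phi> p) \<in> X ` I \<and> coeffs_of (\<Phi> p) = (A' (x_of (\<Phi> p)), B' (x_of (\<Phi> p)))
      \<and> (on_equation p \<longleftrightarrow> on_equation (\<Phi> p))"
    if p: "p \<in> D" "x_of p \<in> J \<and> coeffs_of p = (A (x_of p), B (x_of p))" for p
  proof (intro conjI)
    show "x_of (\<Phi> p) \<in> X ` I" using p by (simp add: x_of_transf I_def)
    have "Y (X (x_of p)) = x_of p" using Y p by blast
    then show "coeffs_of (\<Phi> p) = (A' (x_of (\<Phi> p)), B' (x_of (\<Phi> p)))"
      using p(2) unfolding x_of_transf A'_def B'_def
      by (cases p) (auto simp: x_of_def base_of_def coeffs_of_def)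
    show "on_equation p \<longleftrightarrow> on_equation (\<Phi> p)"
      using on_equation_prolonged_transf[OF nz] X' p by simp
  qed
  ultimately show "\<exists>J' A' B'. arbitrary_elements J' A' B' \<and>
           (\<forall>p\<in>D. x_of p \<in> J \<and> coeffs_of p = (A (x_of p), B (x_of p)) \<longrightarrow>
              x_of (\<Phi> p) \<in> J' \<and>
              coeffs_of (\<Phi> p) = (A' (x_of (\<Phi> p)), B' (x_of (\<Phi> p))) \<and>
              (on_equation p \<longleftrightarrow> on_equation (\<Phi> p)))"
    by blast
qed

lemma in_pseudogroup: "(D, \<Phi>) \<in> equivalence_pseudogroup"
  unfolding equivalence_pseudogroup_def
  using D diffeo_on_transf projectable_transf preserves_contact_transf maps_class_to_class_transf by simp

end

text \<open>The theorem describes the map on \<open>D\<close> only, so membership must be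
  insensitive to values elsewhere; for derivatives this holds because \<open>D\<close> is
  open.\<close>

lemma equivalence_pseudogroup_cong:
  assumes "\<And>p. p \<in> D \<Longrightarrow> \<Phi> p = \<Psi> p"
    and mem: "(D, \<Psi>) \<in> equivalence_pseudogroup"
  shows "(D, \<Phi>) \<in> equivalence_pseudogroup"
proof -
  have D: "open D" and "smooth_on D \<Psi>"
    using mem by (auto simp: equivalence_pseudogroup_def diffeo_on_def)
  have "frechet_derivative \<Psi> (at p) = frechet_derivative \<Phi> (at p)" if "p \<in> D" for p
    using smooth_on_has_derivative[OF \<open>smooth_on D \<Psi>\<close> that] assms(1) that D
    by (intro frechet_derivative_transform_within_open[of _ _ D]) (auto simp: differentiable_def)
  then have "preserves_contact D \<Phi>"
    using mem assms(1) unfolding equivalence_pseudogroup_def preserves_contact_def by simp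
  moreover have "diffeo_on D \<Phi>"
  proof -
    have "\<Phi> ` D = \<Psi> ` D" using assms(1) by auto
    then show ?thesis
      using mem assms(1) smooth_on_cong[OF D assms(1)] unfolding equivalence_pseudogroup_def diffeo_on_def by simp
  qed
  moreover have "maps_class_to_class D \<Phi>"
    using mem assms(1) unfolding equivalence_pseudogroup_def maps_class_to_class_def by simp
  moreover have "projectable D \<Phi> base_of \<longleftrightarrow> projectable D \<Psi> base_of"
    "projectable D \<Phi> jet_of \<longleftrightarrow> projectable D \<Psi> jet_of"
    unfolding projectable_def by (intro ball_cong refl, simp add: assms(1))+
  ultimately show ?thesis using mem by (simp add: equivalence_pseudogroup_def)
qed

section \<open>Derivatives along lines and projections\<close>

abbreviation dd :: "('a::real_normed_vector \<Rightarrow> 'b::real_normed_vector) \<Rightarrow> 'a \<Rightarrow> 'a \<Rightarrow> 'b" where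
  "dd f p v \<equiv> frechet_derivative f (at p) v"

lemma linear_dd: "smooth_on S f \<Longrightarrow> p \<in> S \<Longrightarrow> linear (dd f p)"
  using smooth_on_has_derivative has_derivative_linear by blast

lemma dd_eqI: "(f has_derivative f') (at p) \<Longrightarrow> dd f p v = f' v"
  by (metis frechet_derivative_at)

lemma open_line_in:
  fixes S :: "'a::real_normed_vector set"
  assumes "open S" "p \<in> S"
  obtains e where "e > 0" "\<And>s. \<bar>s\<bar> < e \<Longrightarrow> p + s *\<^sub>R v \<in> S"
proof -
  have "open ((\<lambda>s. p + s *\<^sub>R v) -` S)"
    by (intro open_vimage assms(1)) (auto intro!: continuous_intros)
  moreover have "0 \<in> (\<lambda>s. p + s *\<^sub>R v) -` S" using assms(2) by simp
  ultimately obtain e where "e > 0" "ball 0 e \<subseteq> (\<lambda>s. p + s *\<^sub>R v) -` S"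
    by (meson open_contains_ball)
  then show ?thesis by (intro that[of e]) (auto simp: subset_iff)
qed

lemma has_vector_derivative_line:
  assumes "(f has_derivative f') (at p)"
  shows "((\<lambda>s. f (p + s *\<^sub>R v)) has_vector_derivative f' v) (at 0)"
proof -
  have "((\<lambda>s. p + s *\<^sub>R v) has_derivative (\<lambda>s. s *\<^sub>R v)) (at 0)"
    by (auto intro!: derivative_eq_intros)
  moreover have "(f has_derivative f') (at (p + 0 *\<^sub>R v))" using assms by simp
  ultimately have "((\<lambda>s. f (p + s *\<^sub>R v)) has_derivative (\<lambda>s. f' (s *\<^sub>R v))) (at 0)"
    using has_derivative_compose by blast
  then show ?thesis
    using has_derivative_linear[OF assms] by (simp add: has_vector_derivative_def linear_scale)
qed

lemma dd_line_cong:
  assumes D: "open D" "p \<in> D" "q \<in> D" and f: "smooth_on D f"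
    and eq: "\<And>s. p + s *\<^sub>R v \<in> D \<Longrightarrow> q + s *\<^sub>R w \<in> D \<Longrightarrow> f (p + s *\<^sub>R v) = f (q + s *\<^sub>R w)"
  shows "dd f p v = dd f q w"
proof -
  obtain e where e: "e > 0" "\<And>s. \<bar>s\<bar> < e \<Longrightarrow> p + s *\<^sub>R v \<in> D" using open_line_in[OF D(1,2)] by blast
  obtain e' where e': "e' > 0" "\<And>s. \<bar>s\<bar> < e' \<Longrightarrow> q + s *\<^sub>R w \<in> D" using open_line_in[OF D(1,3)] by blast
  have "((\<lambda>s. f (q + s *\<^sub>R w)) has_vector_derivative dd f q w) (at 0)"
    by (intro has_vector_derivative_line smooth_on_has_derivative[OF f] D)
  then have "((\<lambda>s. f (p + s *\<^sub>R v)) has_vector_derivative dd f q w) (at 0)"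
    by (rule has_vector_derivative_transform_within_open[where S="ball 0 (min e e')"])
       (use e e' eq in auto)
  moreover have "((\<lambda>s. f (p + s *\<^sub>R v)) has_vector_derivative dd f p v) (at 0)"
    by (intro has_vector_derivative_line smooth_on_has_derivative[OF f] D)
  ultimately show ?thesis by (metis vector_derivative_at)
qed

text \<open>Lines through \<open>p\<close> and \<open>q\<close> whose directions have equal
  projections stay over the same points, so \<open>f\<close> agrees along them. Derivatives can thus
  be compared at points that differ in the remaining coordinates.\<close>

lemma dd_factor:
  assumes "linear \<pi>" "open D" "smooth_on D f"
    and "\<And>p q. p \<in> D \<Longrightarrow> q \<in> D \<Longrightarrow> \<pi> p = \<pi> q \<Longrightarrow> f p = f q"
    and "p \<in> D" "q \<in> D" "\<pi> p = \<pi> q" "\<pi> v = \<pi> w"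
  shows "dd f p v = dd f q w"
proof (rule dd_line_cong[OF assms(2,5,6,3)])
  fix s assume "p + s *\<^sub>R v \<in> D" "q + s *\<^sub>R w \<in> D"
  moreover have "\<pi> (p + s *\<^sub>R v) = \<pi> (q + s *\<^sub>R w)"
    by (simp only: linear_add[OF assms(1)] linear_scale[OF assms(1)] assms(7,8))
  ultimately show "f (p + s *\<^sub>R v) = f (q + s *\<^sub>R w)" by (rule assms(4))
qed

lemma dd_factor_zero:
  assumes "linear \<pi>" "open D" "smooth_on D f"
    and "\<And>p q. p \<in> D \<Longrightarrow> q \<in> D \<Longrightarrow> \<pi> p = \<pi> q \<Longrightarrow> f p = f q"
    and "p \<in> D" "\<pi> v = 0"
  shows "dd f p v = 0"
proof -
  have "\<pi> v = \<pi> 0" using assms(6) linear_0[OF assms(1)] by simp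
  from dd_factor[OF assms(1-5,5) refl this] have "dd f p v = dd f p 0" .
  then show ?thesis using linear_0[OF linear_dd[OF assms(3,5)]] by simp
qed

text \<open>Symmetry of second derivatives in the case that one first derivative vanishes:
  \<open>f\<close> is then locally invariant under shifts along \<open>v\<close>, and so is its
  derivative along \<open>w\<close>.\<close>

lemma dd_dd_zero:
  fixes f :: "'a::euclidean_space \<Rightarrow> 'b::euclidean_space"
  assumes D: "open D" and f: "smooth_on D f" and z: "\<And>p. p \<in> D \<Longrightarrow> dd f p v = 0" and "p \<in> D"
  shows "dd (\<lambda>q. dd f q w) p v = 0"
proof -
  let ?g = "\<lambda>q. dd f q w"
  obtain r where r: "r > 0" "ball p r \<subseteq> D" using D \<open>p \<in> D\<close> by (meson open_contains_ball)
  \<comment> \<open>A shift parameter below \<open>e\<close> moves points by less than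
    \<open>r / 2\<close>, so shifts of the ball of radius \<open>r / 2\<close> stay inside
    \<open>D\<close>; the summand 1 covers \<open>v = 0\<close>.\<close>
  define e where "e = r / (2 * (norm v + 1))"
  have "e > 0" using r norm_ge_zero[of v] by (auto simp: e_def intro!: divide_pos_pos add_nonneg_pos)
  have ev: "norm (s *\<^sub>R v) < r / 2" if "\<bar>s\<bar> < e" for s
  proof -
    have "\<bar>s\<bar> * norm v \<le> \<bar>s\<bar> * (norm v + 1)" by (simp add: mult_left_mono)
    also have "\<dots> < e * (norm v + 1)" using that norm_ge_zero[of v] by (intro mult_strict_right_mono) linarith+
    also have "\<dots> = r / 2" using norm_ge_zero[of v] by (simp add: e_def field_simps add_nonneg_eq_0_iff)
    finally show ?thesis by simp
  qed
  have shift: "f (y + s *\<^sub>R v) = f y" if "y \<in> ball p (r/2)" "\<bar>s\<bar> < e" for y s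
  proof -
    have in_D: "y + a *\<^sub>R v \<in> D" if "a \<in> ball 0 e" for a
    proof -
      have "norm (a *\<^sub>R v) < r / 2" using ev that by simp
      moreover have "norm (y - p) < r / 2" using \<open>y \<in> ball p (r/2)\<close> by (simp add: dist_norm norm_minus_commute)
      ultimately have "norm ((y - p) + a *\<^sub>R v) < r"
        using norm_triangle_ineq[of "y - p" "a *\<^sub>R v"] by linarith
      then have "y + a *\<^sub>R v \<in> ball p r"
        by (simp add: dist_norm norm_minus_commute[of p] algebra_simps)
      then show ?thesis using r by blast
    qed
    have "((\<lambda>a. f (y + a *\<^sub>R v)) has_derivative (\<lambda>a. 0)) (at a)" if "a \<in> ball 0 e" for a
    proof -
      have "((\<lambda>a. y + a *\<^sub>R v) has_derivative (\<lambda>b. b *\<^sub>R v)) (at a)"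
        by (auto intro!: derivative_eq_intros)
      from has_derivative_compose[OF this smooth_on_has_derivative[OF f in_D[OF that]]]
      have "((\<lambda>a. f (y + a *\<^sub>R v)) has_derivative (\<lambda>b. dd f (y + a *\<^sub>R v) (b *\<^sub>R v))) (at a)" .
      then show ?thesis
        using linear_scale[OF linear_dd[OF f in_D[OF that]]] z[OF in_D[OF that]] by simp
    qed
    then have "f (y + s *\<^sub>R v) = f (y + 0 *\<^sub>R v)"
      using that \<open>e > 0\<close>
      by (intro has_derivative_zero_unique_connected[of "ball 0 e" "\<lambda>a. f (y + a *\<^sub>R v)"]) auto
    then show ?thesis by simp
  qed
  \<comment> \<open>Near \<open>p\<close> the function coincides with its translate, so the
    derivatives at \<open>p\<close> and at the shifted point agree in all directions.\<close>
  have "?g (p + s *\<^sub>R v) = ?g p" if "\<bar>s\<bar> < e" for s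
  proof -
    have pD: "p + s *\<^sub>R v \<in> D" using ev[OF that] r by (auto simp: subset_iff dist_norm)
    have "((\<lambda>y. y + s *\<^sub>R v) has_derivative (\<lambda>y. y)) (at p)" by (auto intro!: derivative_eq_intros)
    from has_derivative_compose[OF this smooth_on_has_derivative[OF f pD]]
    have "((\<lambda>y. f (y + s *\<^sub>R v)) has_derivative (\<lambda>w. dd f (p + s *\<^sub>R v) w)) (at p)" .
    then have "(f has_derivative (\<lambda>w. dd f (p + s *\<^sub>R v) w)) (at p)"
      by (rule has_derivative_transform_within_open[OF _ open_ball[of p "r/2"]]) (use r shift that in auto)
    then show ?thesis by (metis frechet_derivative_at)
  qed
  then have "((\<lambda>s. ?g (p + s *\<^sub>R v)) has_vector_derivative 0) (at 0)"
    using \<open>e > 0\<close> by (intro has_vector_derivative_transform_within_open[where S="ball 0 e", OF has_vector_derivative_const]) auto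
  moreover have "((\<lambda>s. ?g (p + s *\<^sub>R v)) has_vector_derivative dd ?g p v) (at 0)"
    by (intro has_vector_derivative_line smooth_on_has_derivative[OF smooth_on_frechet_derivative[OF f]] \<open>p \<in> D\<close>)
  ultimately show ?thesis by (metis vector_derivative_at)
qed

text \<open>\<open>R b p\<close> expresses that \<open>p\<close> lies over the parameter
  \<open>b\<close>, and \<open>\<sigma>\<close> lifts parameter increments to increments of points.
  The function induced on the connected set \<open>S\<close> has zero derivative and so is constant,
  even when \<open>D\<close> is disconnected.\<close>

lemma constant_on_sections:
  fixes f :: "'a::euclidean_space \<Rightarrow> 'b::euclidean_space" and R :: "'c::euclidean_space \<Rightarrow> 'a \<Rightarrow> bool"
  assumes D: "open D" "smooth_on D f" and S: "open S" "connected S" "\<And>b. b \<in> S \<Longrightarrow> \<exists>p\<in>D. R b p"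
    and R: "\<And>b p q. p \<in> D \<Longrightarrow> q \<in> D \<Longrightarrow> R b p \<Longrightarrow> R b q \<Longrightarrow> f p = f q"
    and \<sigma>: "linear \<sigma>" "\<And>b h p. R b p \<Longrightarrow> R (b + h) (p + \<sigma> h)"
    and z: "\<And>p h. p \<in> D \<Longrightarrow> dd f p (\<sigma> h) = 0"
    and pq: "p \<in> D" "q \<in> D" "R b p" "R c q" "b \<in> S" "c \<in> S"
  shows "f p = f q"
proof -
  define g where "g b = f (SOME p. p \<in> D \<and> R b p)" for b
  have g: "g b = f p" if "p \<in> D" "R b p" for b p
    unfolding g_def using R that by (metis (mono_tags, lifting) someI)
  have "(g has_derivative (\<lambda>h. 0)) (at b)" if "b \<in> S" for b
  proof -
    obtain p where p: "p \<in> D" "R b p" using S(3) \<open>b \<in> S\<close> by blast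
    \<comment> \<open>On this neighbourhood the induced function equals \<open>f\<close> along an
      affine section through \<open>p\<close>, so it is differentiable whatever points the choice
      operator selects.\<close>
    let ?N = "(\<lambda>b'. p + \<sigma> (b' - b)) -` D"
    have bl: "bounded_linear \<sigma>" using \<sigma>(1) linear_conv_bounded_linear by blast
    have "((\<lambda>b'. p + \<sigma> (b' - b)) has_derivative \<sigma>) (at b)"
      using bounded_linear.has_derivative[OF bl has_derivative_diff[OF has_derivative_ident has_derivative_const]]
      by (intro has_derivative_eq_rhs[OF has_derivative_add[OF has_derivative_const]]) auto
    moreover have "(f has_derivative dd f p) (at (p + \<sigma> (b - b)))"
      using smooth_on_has_derivative[OF D(2) p(1)] linear_0[OF \<sigma>(1)] by simp
    ultimately have "((\<lambda>b'. f (p + \<sigma> (b' - b))) has_derivative (\<lambda>h. dd f p (\<sigma> h))) (at b)"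
      using has_derivative_compose by blast
    then have "((\<lambda>b'. f (p + \<sigma> (b' - b))) has_derivative (\<lambda>h. 0)) (at b)"
      using z[OF p(1)] by simp
    then show ?thesis
    proof (rule has_derivative_transform_within_open)
      show "open ?N"
        by (intro open_vimage D(1) continuous_on_add continuous_on_const bounded_linear.continuous_on[OF bl]
            continuous_on_diff continuous_on_id)
      show "b \<in> ?N" using p linear_0[OF \<sigma>(1)] by simp
      show "f (p + \<sigma> (x - b)) = g x" if "x \<in> ?N" for x
        using g[of "p + \<sigma> (x - b)" x] that \<sigma>(2)[OF p(2), of "x - b"] by simp
    qed
  qed
  then have "g b = g c"
    using has_derivative_zero_unique_connected[OF S(1,2)] pq by blast
  then show ?thesis using g[OF pq(1,3)] g[OF pq(2,4)] by simp
qed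

section \<open>Equivalence transformations\<close>

abbreviation co_t :: "espace \<Rightarrow> real" where "co_t p \<equiv> fst (fst p)"
abbreviation co_x :: "espace \<Rightarrow> real" where "co_x p \<equiv> fst (snd (fst p))"
abbreviation co_u :: "espace \<Rightarrow> real" where "co_u p \<equiv> snd (snd (fst p))"
abbreviation co_ut :: "espace \<Rightarrow> real" where "co_ut p \<equiv> fst (fst (snd p))"
abbreviation co_ux :: "espace \<Rightarrow> real" where "co_ux p \<equiv> fst (snd (fst (snd p)))"
abbreviation co_utt :: "espace \<Rightarrow> real" where "co_utt p \<equiv> fst (snd (snd (fst (snd p))))"
abbreviation co_utx :: "espace \<Rightarrow> real" where "co_utx p \<equiv> fst (snd (snd (snd (fst (snd p)))))"
abbreviation co_uxx :: "espace \<Rightarrow> real" where "co_uxx p \<equiv> snd (snd (snd (snd (fst (snd p)))))"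
abbreviation co_A :: "espace \<Rightarrow> real" where "co_A p \<equiv> fst (snd (snd p))"
abbreviation co_B :: "espace \<Rightarrow> real" where "co_B p \<equiv> snd (snd (snd p))"

definition e_t :: espace where "e_t = ((1, 0, 0), (0, 0, 0, 0, 0), (0, 0))"
definition e_x :: espace where "e_x = ((0, 1, 0), (0, 0, 0, 0, 0), (0, 0))"
definition e_u :: espace where "e_u = ((0, 0, 1), (0, 0, 0, 0, 0), (0, 0))"
definition e_ut :: espace where "e_ut = ((0, 0, 0), (1, 0, 0, 0, 0), (0, 0))"
definition e_ux :: espace where "e_ux = ((0, 0, 0), (0, 1, 0, 0, 0), (0, 0))"
definition e_utt :: espace where "e_utt = ((0, 0, 0), (0, 0, 1, 0, 0), (0, 0))"
definition e_uxx :: espace where "e_uxx = ((0, 0, 0), (0, 0, 0, 0, 1), (0, 0))"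
definition e_A :: espace where "e_A = ((0, 0, 0), (0, 0, 0, 0, 0), (1, 0))"
definition e_B :: espace where "e_B = ((0, 0, 0), (0, 0, 0, 0, 0), (0, 1))"

lemmas e_defs = e_t_def e_x_def e_u_def e_ut_def e_ux_def e_utt_def e_uxx_def e_A_def e_B_def

text \<open>The first-order jet: the transformed first derivatives will factor through it and hence
  be blind to \<open>u_tt\<close>.\<close>

definition jet1_of :: "espace \<Rightarrow> base \<times> real \<times> real" where
  "jet1_of p = (base_of p, co_ut p, co_ux p)"

text \<open>The total derivatives with respect to \<open>t\<close> and \<open>x\<close>, with third-order jet components set to zero.\<close>

definition v_t :: "espace \<Rightarrow> espace" where
  "v_t p = ((1, 0, co_ut p), (co_utt p, co_utx p, 0, 0, 0), (0, 0))"
definition v_x :: "espace \<Rightarrow> espace" where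
  "v_x p = ((0, 1, co_ux p), (co_utx p, co_uxx p, 0, 0, 0), (0, 0))"

lemma contact_v_t: "contact_vector p (v_t p)" and contact_v_x: "contact_vector p (v_x p)"
  by (cases p; auto simp: v_t_def v_x_def)+

lemma bounded_linear_co:
  "bounded_linear co_t" "bounded_linear co_x" "bounded_linear co_u" "bounded_linear co_ut" "bounded_linear co_ux"
  "bounded_linear co_utt" "bounded_linear co_utx" "bounded_linear co_uxx" "bounded_linear co_A" "bounded_linear co_B"
  by (intro bounded_linear_fst_comp bounded_linear_snd_comp bounded_linear_ident)+

lemma linear_base_of: "linear base_of"
  and linear_jet_of: "linear jet_of" and linear_jet1_of: "linear jet1_of"
  and linear_x_of: "linear x_of"
  by (auto intro!: linearI simp: base_of_def jet_of_def jet1_of_def x_of_def)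

lemma on_equation_iff: "on_equation p \<longleftrightarrow> co_ut p = co_A p * co_uxx p + co_B p * co_ux p"
  by (cases p) auto

text \<open>Allows an identity that is valid on all of \<open>D\<close> to be
  differentiated.\<close>

lemma has_derivative_unique_on_open:
  assumes "open D" "p \<in> D" "\<And>q. q \<in> D \<Longrightarrow> f q = g q"
    and "(f has_derivative f') (at p)" "(g has_derivative g') (at p)"
  shows "f' v = g' v"
proof -
  have "(g has_derivative f') (at p)"
    by (rule has_derivative_transform_within_open[OF assms(4,1,2,3)])
  then show ?thesis using has_derivative_unique assms(5) by metis
qed

section \<open>Necessity: components of an arbitrary equivalence transformation\<close>

locale equiv_transf =
  fixes D :: "espace set" and \<Phi> :: "espace \<Rightarrow> espace"
  assumes mem: "(D, \<Phi>) \<in> equivalence_pseudogroup"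
begin

lemma D: "local_domain D" and diffeo: "diffeo_on D \<Phi>"
  and proj_base: "projectable D \<Phi> base_of" and proj_jet: "projectable D \<Phi> jet_of"
  and contact: "preserves_contact D \<Phi>" and class_map: "maps_class_to_class D \<Phi>"
  using mem by (auto simp: equivalence_pseudogroup_def)

lemma class_mapE:
  assumes "arbitrary_elements J A B"
  obtains J' A' B' where "arbitrary_elements J' A' B'"
    "\<And>p. p \<in> D \<Longrightarrow> x_of p \<in> J \<Longrightarrow> coeffs_of p = (A (x_of p), B (x_of p)) \<Longrightarrow>
      x_of (\<Phi> p) \<in> J' \<and> coeffs_of (\<Phi> p) = (A' (x_of (\<Phi> p)), B' (x_of (\<Phi> p))) \<and>
      (on_equation p \<longleftrightarrow> on_equation (\<Phi> p))"
proof -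
  have "\<exists>J' A' B'. arbitrary_elements J' A' B' \<and>
           (\<forall>p\<in>D. x_of p \<in> J \<and> coeffs_of p = (A (x_of p), B (x_of p)) \<longrightarrow>
              x_of (\<Phi> p) \<in> J' \<and> coeffs_of (\<Phi> p) = (A' (x_of (\<Phi> p)), B' (x_of (\<Phi> p))) \<and>
              (on_equation p \<longleftrightarrow> on_equation (\<Phi> p)))"
    by (rule class_map[unfolded maps_class_to_class_def, rule_format, OF assms])
  then show ?thesis by (elim exE conjE) (rule that, assumption, simp)
qed

lemmas op = local_domain_projections(1)[OF D]

lemma smooth: "smooth_on D \<Phi>" using diffeo by (simp add: diffeo_on_def)

definition "T = (\<lambda>p. co_t (\<Phi> p))"
definition "X = (\<lambda>p. co_x (\<Phi> p))"
definition "U = (\<lambda>p. co_u (\<Phi> p))"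
definition "Ut = (\<lambda>p. co_ut (\<Phi> p))"
definition "Ux = (\<lambda>p. co_ux (\<Phi> p))"
definition "Utt = (\<lambda>p. co_utt (\<Phi> p))"
definition "Utx = (\<lambda>p. co_utx (\<Phi> p))"
definition "Uxx = (\<lambda>p. co_uxx (\<Phi> p))"
definition "Ac = (\<lambda>p. co_A (\<Phi> p))"
definition "Bc = (\<lambda>p. co_B (\<Phi> p))"

lemmas comp_defs = T_def X_def U_def Ut_def Ux_def Utt_def Utx_def Uxx_def Ac_def Bc_def

lemma
  assumes "bounded_linear c"
  shows smooth_component: "smooth_on D (\<lambda>p. c (\<Phi> p))"
    and dd_component: "p \<in> D \<Longrightarrow> dd (\<lambda>p. c (\<Phi> p)) p v = c (dd \<Phi> p v)"
proof -
  show "smooth_on D (\<lambda>p. c (\<Phi> p))"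
    using smooth_on_compose[OF smooth_on_bounded_linear[OF assms open_UNIV] op open_UNIV _ smooth] by simp
  show "p \<in> D \<Longrightarrow> dd (\<lambda>p. c (\<Phi> p)) p v = c (dd \<Phi> p v)"
    by (rule dd_eqI[OF bounded_linear.has_derivative[OF assms smooth_on_has_derivative[OF smooth]]])
qed

lemmas smooth_comp = smooth_component[OF bounded_linear_co(1), folded T_def]
  smooth_component[OF bounded_linear_co(2), folded X_def] smooth_component[OF bounded_linear_co(3), folded U_def]
  smooth_component[OF bounded_linear_co(4), folded Ut_def] smooth_component[OF bounded_linear_co(5), folded Ux_def]
  smooth_component[OF bounded_linear_co(9), folded Ac_def] smooth_component[OF bounded_linear_co(10), folded Bc_def]

lemmas dd_comp = dd_component[OF bounded_linear_co(1), folded T_def]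
  dd_component[OF bounded_linear_co(2), folded X_def] dd_component[OF bounded_linear_co(3), folded U_def]
  dd_component[OF bounded_linear_co(4), folded Ut_def] dd_component[OF bounded_linear_co(5), folded Ux_def]
  dd_component[OF bounded_linear_co(9), folded Ac_def] dd_component[OF bounded_linear_co(10), folded Bc_def]

text \<open>A function on the projected space is represented by its pullback to \<open>D\<close>, so
  that all derivatives are taken in the extended space.\<close>

definition factors_through :: "(espace \<Rightarrow> 'b) \<Rightarrow> (espace \<Rightarrow> 'c::euclidean_space) \<Rightarrow> bool" where
  "factors_through \<pi> f \<longleftrightarrow> smooth_on D f \<and> (\<forall>p\<in>D. \<forall>q\<in>D. \<pi> p = \<pi> q \<longrightarrow> f p = f q)"

lemma factors_throughD:
  assumes "factors_through \<pi> f"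
  shows "smooth_on D f" "p \<in> D \<Longrightarrow> q \<in> D \<Longrightarrow> \<pi> p = \<pi> q \<Longrightarrow> f p = f q"
  using assms unfolding factors_through_def by blast+

lemma factors_dd_eq:
  assumes "factors_through \<pi> f" "linear \<pi>" "p \<in> D" "q \<in> D" "\<pi> p = \<pi> q" "\<pi> v = \<pi> w"
  shows "dd f p v = dd f q w"
  using dd_factor[OF assms(2) op, of f] factors_throughD[OF assms(1)] assms(3-) by blast

lemma factors_dd_zero:
  assumes "factors_through \<pi> f" "linear \<pi>" "p \<in> D" "\<pi> v = 0"
  shows "dd f p v = 0"
  using dd_factor_zero[OF assms(2) op, of f] factors_throughD[OF assms(1)] assms(3-) by blast

lemma factors_dd:
  assumes "factors_through \<pi> f" "linear \<pi>"
  shows "factors_through \<pi> (\<lambda>p. dd f p v)"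
  using smooth_on_frechet_derivative[OF factors_throughD(1)[OF assms(1)]] factors_dd_eq[OF assms _ _ _ refl]
  unfolding factors_through_def by blast

lemma base_expand:
  fixes f :: "espace \<Rightarrow> real"
  assumes f: "factors_through base_of f" and p: "p \<in> D"
  shows "dd f p v = co_t v * dd f p e_t + co_x v * dd f p e_x + co_u v * dd f p e_u"
proof -
  note lin = linear_dd[OF factors_throughD(1)[OF f] p]
  have "dd f p v = dd f p (co_t v *\<^sub>R e_t + co_x v *\<^sub>R e_x + co_u v *\<^sub>R e_u)"
    by (rule factors_dd_eq[OF f linear_base_of p p refl]) (auto simp: base_of_def e_defs prod_eq_iff)
  also have "\<dots> = co_t v * dd f p e_t + co_x v * dd f p e_x + co_u v * dd f p e_u"
    by (simp add: linear_add[OF lin] linear_scale[OF lin])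
  finally show ?thesis .
qed

lemma base_fun: "factors_through base_of T" "factors_through base_of X" "factors_through base_of U"
proof -
  have "T p = T q \<and> X p = X q \<and> U p = U q" if "p \<in> D" "q \<in> D" "base_of p = base_of q" for p q
  proof -
    have "base_of (\<Phi> p) = base_of (\<Phi> q)" using proj_base that unfolding projectable_def by blast
    then show ?thesis by (simp add: comp_defs base_of_def)
  qed
  then show "factors_through base_of T" "factors_through base_of X" "factors_through base_of U"
    unfolding factors_through_def using smooth_comp(1-3) by blast+
qed

lemmas base_fun_dd = base_fun[THEN factors_dd, OF linear_base_of]

text \<open>Infinitesimal projectability: a direction that changes only \<open>A\<close> and
  \<open>B\<close> changes only the transformed \<open>A\<close> and \<open>B\<close>.\<close>

lemma dd_\<Phi>_jet:
  assumes "p \<in> D" "jet_of v = 0" shows "jet_of (dd \<Phi> p v) = 0"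
proof -
  have bl: "bounded_linear jet_of" using linear_jet_of linear_conv_bounded_linear by blast
  have "factors_through jet_of (\<lambda>p. jet_of (\<Phi> p))"
    using proj_jet smooth_component[OF bl] unfolding factors_through_def projectable_def by blast
  from factors_dd_zero[OF this linear_jet_of assms] show ?thesis
    using dd_component[OF bl assms(1)] by simp
qed

lemma dd_\<Phi>_inj:
  assumes "p \<in> D" "dd \<Phi> p v = 0" shows "v = 0"
proof -
  obtain \<Psi> where \<Psi>: "smooth_on (\<Phi> ` D) \<Psi>" "\<And>p. p \<in> D \<Longrightarrow> \<Psi> (\<Phi> p) = p" and "open (\<Phi> ` D)"
    using diffeo by (auto simp: diffeo_on_def)
  have "(\<Psi> has_derivative dd \<Psi> (\<Phi> p)) (at (\<Phi> p))"
    using \<Psi>(1) assms(1) by (intro smooth_on_has_derivative) auto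
  from has_derivative_compose[OF smooth_on_has_derivative[OF smooth assms(1)] this]
  have "((\<lambda>q. \<Psi> (\<Phi> q)) has_derivative (\<lambda>v. dd \<Psi> (\<Phi> p) (dd \<Phi> p v))) (at p)" .
  from has_derivative_unique_on_open[OF op assms(1) \<Psi>(2) this has_derivative_ident]
  have "dd \<Psi> (\<Phi> p) (dd \<Phi> p v) = v" .
  moreover have "dd \<Psi> (\<Phi> p) 0 = 0"
    using linear_0[OF linear_dd[OF \<Psi>(1)]] assms(1) by blast
  ultimately show ?thesis using assms(2) by simp
qed

lemma dd_\<Phi>_surj:
  assumes "p \<in> D" shows "\<exists>v. dd \<Phi> p v = w"
proof -
  note lin = linear_dd[OF smooth assms]
  have "inj (dd \<Phi> p)" using linear_injective_0[OF lin] dd_\<Phi>_inj[OF assms] by blast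
  then have "surj (dd \<Phi> p)" using linear_injective_imp_surjective[OF lin] by blast
  then show ?thesis by (metis surjD)
qed

text \<open>The direction \<open>v\<close> is tangent to the graph of affine coefficients with
  slopes \<open>a\<close> and \<open>b\<close>. Along the line in this direction the new
  coefficients are functions of the new \<open>x\<close>, which is stationary to first
  order.\<close>

lemma graph_derivative:
  assumes p: "p \<in> D" and v: "co_A v = a * co_x v" "co_B v = b * co_x v" and 0: "dd X p v = 0"
  shows "dd Ac p v = 0" "dd Bc p v = 0"
proof -
  define A where "A y = co_A p + a * (y - co_x p)" for y
  define B where "B y = co_B p + b * (y - co_x p)" for y
  \<comment> \<open>Only nonvanishing \<open>A\<close> is admissible, so a zero of the affine
    function is cut out; the value at \<open>p\<close> is nonzero, so the line survives near
    \<open>p\<close>.\<close>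
  define J where "J = {y. A y \<noteq> 0}"
  have J: "open J" unfolding J_def A_def by (intro open_Collect_neq continuous_intros)
  have "arbitrary_elements J A B"
    unfolding arbitrary_elements_def A_def B_def using J
    by (intro conjI smooth_intros) (auto simp: J_def A_def)
  from class_mapE[OF this] obtain J' A' B' where ae: "arbitrary_elements J' A' B'"
    and *: "\<And>q. q \<in> D \<Longrightarrow> x_of q \<in> J \<Longrightarrow> coeffs_of q = (A (x_of q), B (x_of q)) \<Longrightarrow>
              x_of (\<Phi> q) \<in> J' \<and> coeffs_of (\<Phi> q) = (A' (x_of (\<Phi> q)), B' (x_of (\<Phi> q))) \<and>
              (on_equation q \<longleftrightarrow> on_equation (\<Phi> q))"
    by blast
  obtain e where e: "e > 0" "\<And>s. \<bar>s\<bar> < e \<Longrightarrow> p + s *\<^sub>R v \<in> D" using open_line_in[OF op p] by blast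
  have "open ((\<lambda>s. co_x p + s * co_x v) -` J)"
    using J by (intro open_vimage) (auto intro!: continuous_intros)
  moreover have "co_A p \<noteq> 0" using D p by (auto simp: local_domain_def coeffs_of_def)
  then have "0 \<in> (\<lambda>s. co_x p + s * co_x v) -` J" by (simp add: J_def A_def)
  ultimately obtain e' where "e' > 0" and sub: "ball 0 e' \<subseteq> (\<lambda>s. co_x p + s * co_x v) -` J"
    by (meson open_contains_ball)
  then have e': "e' > 0" "\<And>s. s \<in> ball 0 e' \<Longrightarrow> co_x p + s * co_x v \<in> J"
    by (auto simp: subset_iff)
  define r where "r = min e e'"
  have r: "r > 0" using e e' by (simp add: r_def)
  have graph: "X (p + s *\<^sub>R v) \<in> J' \<and> Ac (p + s *\<^sub>R v) = A' (X (p + s *\<^sub>R v)) \<and> Bc (p + s *\<^sub>R v) = B' (X (p + s *\<^sub>R v))"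
    if "s \<in> ball 0 r" for s
  proof -
    have "p + s *\<^sub>R v \<in> D" using e that by (simp add: r_def)
    moreover have "x_of (p + s *\<^sub>R v) \<in> J" using e'(2)[of s] that by (simp add: r_def x_of_def base_of_def)
    moreover have "coeffs_of (p + s *\<^sub>R v) = (A (x_of (p + s *\<^sub>R v)), B (x_of (p + s *\<^sub>R v)))"
      using v by (simp add: coeffs_of_def x_of_def base_of_def A_def B_def prod_eq_iff)
    ultimately show ?thesis
      using *[of "p + s *\<^sub>R v"] by (auto simp: coeffs_of_def x_of_def base_of_def comp_defs prod_eq_iff)
  qed
  have zero: "dd C p v = 0"
    if C: "smooth_on D C" and g: "\<And>s. s \<in> ball 0 r \<Longrightarrow> C (p + s *\<^sub>R v) = g (X (p + s *\<^sub>R v))" and sg: "smooth_on J' g"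
    for C g :: "_ \<Rightarrow> real"
  proof -
    have "X p \<in> J'" using graph[of 0] r by simp
    have "((\<lambda>q. g (X q)) has_derivative (\<lambda>w. dd g (X p) (dd X p w))) (at p)"
      by (rule has_derivative_compose[OF smooth_on_has_derivative[OF smooth_comp(2) p] smooth_on_has_derivative[OF sg \<open>X p \<in> J'\<close>]])
    from has_vector_derivative_line[OF this]
    have "((\<lambda>s. g (X (p + s *\<^sub>R v))) has_vector_derivative dd g (X p) (dd X p v)) (at 0)" .
    moreover have "dd g (X p) (dd X p v) = 0"
      using 0 linear_0[OF linear_dd[OF sg \<open>X p \<in> J'\<close>]] by simp
    ultimately have "((\<lambda>s. g (X (p + s *\<^sub>R v))) has_vector_derivative 0) (at 0)" by simp
    then have "((\<lambda>s. C (p + s *\<^sub>R v)) has_vector_derivative 0) (at 0)"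
      by (rule has_vector_derivative_transform_within_open[where S="ball 0 r"]) (use r g in auto)
    moreover have "((\<lambda>s. C (p + s *\<^sub>R v)) has_vector_derivative dd C p v) (at 0)"
      by (intro has_vector_derivative_line smooth_on_has_derivative[OF C p])
    ultimately show ?thesis by (metis vector_derivative_at)
  qed
  show "dd Ac p v = 0" using graph ae by (intro zero[of _ A'] smooth_comp) (auto simp: arbitrary_elements_def)
  show "dd Bc p v = 0" using graph ae by (intro zero[of _ B'] smooth_comp) (auto simp: arbitrary_elements_def)
qed

text \<open>Changing the slope of \<open>A\<close> alters the tangent direction by a multiple of
  \<open>e_A\<close>, while the derivative of \<open>X\<close> sees base components only. The
  difference of two such directions shows that the derivative of an invertible map would annihilate
  \<open>e_A\<close>.\<close>

lemma dd_X_kernel: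
  assumes p: "p \<in> D" and 0: "dd X p v = 0" shows "co_x v = 0"
proof (rule ccontr)
  assume nz: "co_x v \<noteq> 0"
  define w :: "real \<Rightarrow> espace" where "w a = (fst v, (0, 0, 0, 0, 0), (a * co_x v, 0))" for a
  have w: "dd X p (w a) = 0" for a
    using factors_dd_eq[OF base_fun(2) linear_base_of p p refl, of "w a" v] 0 by (simp add: w_def base_of_def)
  have c: "dd Ac p (w a) = 0" "dd Bc p (w a) = 0" for a
    by (rule graph_derivative[OF p _ _ w, where a=a and b=0]; simp add: w_def)+
  have e: "co_x v *\<^sub>R e_A = w 1 - w 0" by (simp add: w_def e_defs prod_eq_iff)
  have "dd Ac p (co_x v *\<^sub>R e_A) = 0" "dd Bc p (co_x v *\<^sub>R e_A) = 0"
    unfolding e using linear_diff[OF linear_dd[OF smooth_comp(6) p]] linear_diff[OF linear_dd[OF smooth_comp(7) p]] c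
    by simp_all
  then have "coeffs_of (dd \<Phi> p (co_x v *\<^sub>R e_A)) = 0"
    using dd_comp(6,7)[OF p] by (simp add: coeffs_of_def prod_eq_iff)
  moreover have "jet_of (dd \<Phi> p (co_x v *\<^sub>R e_A)) = 0"
    by (rule dd_\<Phi>_jet[OF p]) (simp add: jet_of_def e_defs prod_eq_iff)
  ultimately have "dd \<Phi> p (co_x v *\<^sub>R e_A) = 0"
    by (simp add: coeffs_of_def jet_of_def prod_eq_iff)
  from dd_\<Phi>_inj[OF p this] nz show False by (simp add: e_defs prod_eq_iff)
qed

lemma X_x_nonzero: "p \<in> D \<Longrightarrow> dd X p e_x \<noteq> 0"
  using dd_X_kernel[of p e_x] by (auto simp: e_defs)

text \<open>Each of the two combinations formed in the proof is killed by the derivative of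
  \<open>X\<close>, and its \<open>x\<close>-component is minus the derivative in question.\<close>

lemma X_t_u_zero:
  assumes p: "p \<in> D" shows "dd X p e_t = 0" "dd X p e_u = 0"
proof -
  note lin = linear_dd[OF smooth_comp(2) p]
  have "dd X p (dd X p e_x *\<^sub>R e_t - dd X p e_t *\<^sub>R e_x) = 0"
    "dd X p (dd X p e_x *\<^sub>R e_u - dd X p e_u *\<^sub>R e_x) = 0"
    by (simp_all add: linear_diff[OF lin] linear_scale[OF lin])
  then show "dd X p e_t = 0" "dd X p e_u = 0"
    using dd_X_kernel[OF p, of "dd X p e_x *\<^sub>R e_t - dd X p e_t *\<^sub>R e_x"]
      dd_X_kernel[OF p, of "dd X p e_x *\<^sub>R e_u - dd X p e_u *\<^sub>R e_x"] by (simp_all add: e_defs)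
qed

lemma dd_X: "p \<in> D \<Longrightarrow> dd X p v = co_x v * dd X p e_x"
  using base_expand[OF base_fun(2), of p v] X_t_u_zero by simp

text \<open>Directions producing pure motions of the new \<open>t\<close> and of the new
  \<open>u\<close> have no \<open>x\<close>-component, so their \<open>(t, u)\<close>-parts invert
  the 2 by 2 matrix of \<open>T\<close> and \<open>U\<close>.\<close>

lemma jacobian_nonzero:
  assumes p: "p \<in> D" shows "dd T p e_t * dd U p e_u - dd T p e_u * dd U p e_t \<noteq> 0"
proof
  assume 0: "dd T p e_t * dd U p e_u - dd T p e_u * dd U p e_t = 0"
  obtain v where v: "dd \<Phi> p v = ((1, 0, 0), 0, 0)" using dd_\<Phi>_surj[OF p] by blast
  obtain w where w: "dd \<Phi> p w = ((0, 0, 1), 0, 0)" using dd_\<Phi>_surj[OF p] by blast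
  have "dd X p v = 0" "dd X p w = 0" using dd_comp(2)[OF p] v w by simp_all
  then have x: "co_x v = 0" "co_x w = 0" using dd_X_kernel[OF p] by blast+
  have T: "dd T p v = 1" "dd T p w = 0" and U: "dd U p v = 0" "dd U p w = 1"
    using dd_comp(1,3)[OF p] v w by simp_all
  have 1: "co_t v * dd T p e_t + co_u v * dd T p e_u = 1" "co_t w * dd T p e_t + co_u w * dd T p e_u = 0"
    "co_t v * dd U p e_t + co_u v * dd U p e_u = 0" "co_t w * dd U p e_t + co_u w * dd U p e_u = 1"
    using base_expand[OF base_fun(1) p, of v] base_expand[OF base_fun(3) p, of v]
      base_expand[OF base_fun(1) p, of w] base_expand[OF base_fun(3) p, of w] x T U by simp_all
  \<comment> \<open>Multiplicativity of determinants: the right-hand side is 1, while the assumption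
    makes the left-hand side 0.\<close>
  have "(co_t v * co_u w - co_u v * co_t w) * (dd T p e_t * dd U p e_u - dd T p e_u * dd U p e_t)
      = (co_t v * dd T p e_t + co_u v * dd T p e_u) * (co_t w * dd U p e_t + co_u w * dd U p e_u)
      - (co_t w * dd T p e_t + co_u w * dd T p e_u) * (co_t v * dd U p e_t + co_u v * dd U p e_u)"
    by (simp add: algebra_simps)
  then show False using 0 1 by simp
qed

section \<open>Contact condition and prolongation formulas\<close>

lemma contact_relations:
  assumes p: "p \<in> D" and "contact_vector p v"
  shows "dd U p v = Ut p * dd T p v + Ux p * dd X p v"
    "dd Ut p v = Utt p * dd T p v + Utx p * dd X p v"
    "dd Ux p v = Utx p * dd T p v + Uxx p * dd X p v"
proof -
  have c: "contact_vector (\<Phi> p) (dd \<Phi> p v)"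
    using contact assms unfolding preserves_contact_def by blast
  have "contact_vector q w \<longleftrightarrow> co_u w = co_ut q * co_t w + co_ux q * co_x w
    \<and> co_ut w = co_utt q * co_t w + co_utx q * co_x w \<and> co_ux w = co_utx q * co_t w + co_uxx q * co_x w" for q w
    by (cases q; cases w) auto
  with c show "dd U p v = Ut p * dd T p v + Ux p * dd X p v"
    "dd Ut p v = Utt p * dd T p v + Utx p * dd X p v"
    "dd Ux p v = Utx p * dd T p v + Uxx p * dd X p v"
    unfolding dd_comp[OF p] by (auto simp: comp_defs)
qed

lemma first_prolongation:
  assumes p: "p \<in> D"
  shows "dd U p e_t + co_ut p * dd U p e_u = Ut p * (dd T p e_t + co_ut p * dd T p e_u)"
    "dd U p e_x + co_ux p * dd U p e_u = Ut p * (dd T p e_x + co_ux p * dd T p e_u) + Ux p * dd X p e_x"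
  using contact_relations(1)[OF p contact_v_t] contact_relations(1)[OF p contact_v_x]
    base_expand[OF base_fun(1) p, of "v_t p"] base_expand[OF base_fun(3) p, of "v_t p"] dd_X[OF p, of "v_t p"]
    base_expand[OF base_fun(1) p, of "v_x p"] base_expand[OF base_fun(3) p, of "v_x p"] dd_X[OF p, of "v_x p"]
  by (simp_all add: v_t_def v_x_def)

text \<open>If \<open>D_t T\<close> vanished, the prolongation formula would give
  \<open>D_t U = 0\<close> as well, making the \<open>t\<close>- and \<open>u\<close>-columns of the
  Jacobian proportional.\<close>

lemma DtT_nonzero:
  assumes p: "p \<in> D" shows "dd T p e_t + co_ut p * dd T p e_u \<noteq> 0"
proof
  assume "dd T p e_t + co_ut p * dd T p e_u = 0"
  then have "dd T p e_t = - co_ut p * dd T p e_u" "dd U p e_t = - co_ut p * dd U p e_u"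
    using first_prolongation(1)[OF p] by simp_all
  then show False using jacobian_nonzero[OF p] by (simp add: algebra_simps)
qed

text \<open>Testing the class condition on constant coefficients suits all comparisons of points
  with equal coefficients: a single target equation serves them all, whatever their base points and
  derivatives.\<close>

lemma constant_coeffsE:
  assumes "p \<in> D"
  obtains A' B' where "A' (X p) \<noteq> 0"
    "\<And>q. q \<in> D \<Longrightarrow> coeffs_of q = coeffs_of p \<Longrightarrow>
      Ac q = A' (X q) \<and> Bc q = B' (X q) \<and> (on_equation q \<longleftrightarrow> on_equation (\<Phi> q))"
proof -
  obtain a b where ab: "coeffs_of p = (a, b)" by (cases "coeffs_of p")
  have "a \<noteq> 0" using D assms(1) ab by (force simp: local_domain_def)
  then have "arbitrary_elements UNIV (\<lambda>_. a) (\<lambda>_. b)"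
    by (auto simp: arbitrary_elements_def intro!: smooth_intros)
  from class_mapE[OF this] obtain J' A' B' where ae: "arbitrary_elements J' A' B'"
    and *: "\<And>q. q \<in> D \<Longrightarrow> coeffs_of q = (a, b) \<Longrightarrow>
              x_of (\<Phi> q) \<in> J' \<and> coeffs_of (\<Phi> q) = (A' (x_of (\<Phi> q)), B' (x_of (\<Phi> q))) \<and>
              (on_equation q \<longleftrightarrow> on_equation (\<Phi> q))"
    by auto
  have "X p \<in> J'" using *[OF assms ab] by (simp add: x_of_def base_of_def X_def)
  then show ?thesis
    using ae ab * by (intro that[of A' B']) (auto simp: arbitrary_elements_def coeffs_of_def comp_defs x_of_def base_of_def)
qed

lemma coeffs_same:
  assumes "p \<in> D" "q \<in> D" "X p = X q" "coeffs_of p = coeffs_of q"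
  shows "Ac p = Ac q" "Bc p = Bc q"
  by (rule constant_coeffsE[OF assms(1)]; use assms in simp)+

lemma on_equation_image:
  assumes "p \<in> D" "on_equation p"
  shows "Ac p \<noteq> 0" "Ut p = Ac p * Uxx p + Bc p * Ux p"
proof -
  have "Ac p \<noteq> 0 \<and> on_equation (\<Phi> p)"
    by (rule constant_coeffsE[OF assms(1)]) (use assms in simp)
  then show "Ac p \<noteq> 0" "Ut p = Ac p * Uxx p + Bc p * Ux p"
    by (simp_all add: on_equation_iff comp_defs)
qed

lemma same_base:
  assumes "p \<in> D" "q \<in> D" "base_of p = base_of q"
  shows "X p = X q" "dd T p v = dd T q v" "dd X p v = dd X q v" "dd U p v = dd U q v"
  using base_fun[THEN factors_throughD(2)] base_fun_dd[THEN factors_throughD(2)] assms by blast+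

lemma ex_on_equation:
  assumes "p \<in> D"
  obtains q where "q \<in> D" "base_of q = base_of p" "coeffs_of q = coeffs_of p" "on_equation q"
  using D assms unfolding local_domain_def by blast

lemma jet1_base: "jet1_of p = jet1_of q \<Longrightarrow> base_of p = base_of q \<and> co_ut p = co_ut q \<and> co_ux p = co_ux q"
  by (simp add: jet1_of_def)

text \<open>The prolongation formulas can be solved for \<open>Ut\<close> and then for
  \<open>Ux\<close>: the factors \<open>D_t T\<close> and \<open>X_x\<close> are nonzero, and only
  first-order data remain.\<close>

lemma jet1_fun: "factors_through jet1_of Ut" "factors_through jet1_of Ux"
proof -
  have eq: "Ut p = Ut q \<and> Ux p = Ux q" if pq: "p \<in> D" "q \<in> D" "jet1_of p = jet1_of q" for p q
  proof -
    have j: "base_of p = base_of q" "co_ut p = co_ut q" "co_ux p = co_ux q" using jet1_base[OF pq(3)] by auto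
    note b = same_base[OF pq(1,2) j(1)]
    have "Ut p * (dd T p e_t + co_ut p * dd T p e_u) = Ut q * (dd T p e_t + co_ut p * dd T p e_u)"
      using first_prolongation(1)[OF pq(1)] first_prolongation(1)[OF pq(2)] by (simp only: b j)
    then have Ut: "Ut p = Ut q" using DtT_nonzero[OF pq(1)] by simp
    have "Ux p * dd X p e_x = Ux q * dd X p e_x"
      using first_prolongation(2)[OF pq(1)] first_prolongation(2)[OF pq(2)] by (auto simp: b j Ut)
    then show ?thesis using Ut X_x_nonzero[OF pq(1)] by simp
  qed
  show "factors_through jet1_of Ut" "factors_through jet1_of Ux"
    unfolding factors_through_def using eq smooth_comp(4,5) by blast+
qed

lemma smooth_dd: "smooth_on D f \<Longrightarrow> p \<in> D \<Longrightarrow> ((\<lambda>q. dd f q e) has_derivative dd (\<lambda>q. dd f q e) p) (at p)"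
  by (rule smooth_on_has_derivative[OF smooth_on_frechet_derivative])

lemma first_prolongation_dd:
  assumes p: "p \<in> D"
  shows "dd (\<lambda>p. dd U p e_t) p v + (co_ut p * dd (\<lambda>p. dd U p e_u) p v + co_ut v * dd U p e_u)
      = Ut p * (dd (\<lambda>p. dd T p e_t) p v + (co_ut p * dd (\<lambda>p. dd T p e_u) p v + co_ut v * dd T p e_u))
        + dd Ut p v * (dd T p e_t + co_ut p * dd T p e_u)"
    and "dd (\<lambda>p. dd U p e_x) p v + (co_ux p * dd (\<lambda>p. dd U p e_u) p v + co_ux v * dd U p e_u)
      = Ut p * (dd (\<lambda>p. dd T p e_x) p v + (co_ux p * dd (\<lambda>p. dd T p e_u) p v + co_ux v * dd T p e_u))
        + dd Ut p v * (dd T p e_x + co_ux p * dd T p e_u)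
        + (Ux p * dd (\<lambda>p. dd X p e_x) p v + dd Ux p v * dd X p e_x)"
proof -
  note co = bounded_linear_imp_has_derivative[OF bounded_linear_co(4), of "at p"]
    bounded_linear_imp_has_derivative[OF bounded_linear_co(5), of "at p"]
  note sd = smooth_comp[THEN smooth_dd, OF p]
  note sc = smooth_comp[THEN smooth_on_has_derivative, OF p]
  note mult = has_derivative_mult and add = has_derivative_add
  show "dd (\<lambda>p. dd U p e_t) p v + (co_ut p * dd (\<lambda>p. dd U p e_u) p v + co_ut v * dd U p e_u)
      = Ut p * (dd (\<lambda>p. dd T p e_t) p v + (co_ut p * dd (\<lambda>p. dd T p e_u) p v + co_ut v * dd T p e_u))
        + dd Ut p v * (dd T p e_t + co_ut p * dd T p e_u)"
    by (rule has_derivative_unique_on_open[OF op p first_prolongation(1)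
          add[OF sd(3) mult[OF co(1) sd(3)]] mult[OF sc(4) add[OF sd(1) mult[OF co(1) sd(1)]]]])
  show "dd (\<lambda>p. dd U p e_x) p v + (co_ux p * dd (\<lambda>p. dd U p e_u) p v + co_ux v * dd U p e_u)
      = Ut p * (dd (\<lambda>p. dd T p e_x) p v + (co_ux p * dd (\<lambda>p. dd T p e_u) p v + co_ux v * dd T p e_u))
        + dd Ut p v * (dd T p e_x + co_ux p * dd T p e_u)
        + (Ux p * dd (\<lambda>p. dd X p e_x) p v + dd Ux p v * dd X p e_x)"
    by (rule has_derivative_unique_on_open[OF op p first_prolongation(2)
          add[OF sd(3) mult[OF co(2) sd(3)]]
          add[OF mult[OF sc(4) add[OF sd(1) mult[OF co(2) sd(1)]]] mult[OF sc(5) sd(2)]]])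
qed

text \<open>If \<open>D_x T\<close> were nonzero, the freedom of \<open>u_tt\<close> would propagate
  through the contact relations until \<open>Ux\<close> and \<open>Ut\<close> lost their dependence
  on \<open>u_t\<close>, against the nonzero Jacobian.\<close>

lemma DxT_zero:
  assumes q: "q \<in> D" and on: "on_equation q"
  shows "dd T q e_x + co_ux q * dd T q e_u = 0"
proof (rule ccontr)
  assume nz: "dd T q e_x + co_ux q * dd T q e_u \<noteq> 0"
  obtain e where e: "e > 0" "\<And>s. \<bar>s\<bar> < e \<Longrightarrow> q + s *\<^sub>R e_utt \<in> D" using open_line_in[OF op q] by blast
  define s where "s = e / 2"
  define p where "p = q + s *\<^sub>R e_utt"
  have s: "s \<noteq> 0" and p: "p \<in> D" using e by (auto simp: s_def p_def)
  have b: "base_of p = base_of q" "coeffs_of p = coeffs_of q" "jet1_of p = jet1_of q"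
    by (simp_all add: p_def e_defs base_of_def coeffs_of_def jet1_of_def prod_eq_iff)
  have on': "on_equation p" using on by (simp add: on_equation_iff p_def e_defs)
  note sb = same_base[OF p q b(1)]
  have U1: "Ut p = Ut q" "Ux p = Ux q" using jet1_fun[THEN factors_throughD(2), OF p q b(3)] by auto
  note co = coeffs_same[OF p q sb(1) b(2)]
  \<comment> \<open>Both points satisfy the same equation, which does not contain
    \<open>u_tt\<close>; the image equation determines \<open>Uxx\<close> because \<open>Ac\<close>
    is nonzero.\<close>
  have Uxx: "Uxx p = Uxx q"
    using on_equation_image[OF p on'] on_equation_image[OF q on] by (simp add: U1 co)
  have dUx: "dd Ux p v = dd Ux q v" for v
    by (rule factors_dd_eq[OF jet1_fun(2) linear_jet1_of p q b(3) refl])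
  have vx: "v_x p = v_x q" and vt: "v_t p = v_t q + s *\<^sub>R e_ut"
    by (simp_all add: v_x_def v_t_def p_def e_defs)
  \<comment> \<open>In the third contact relation along \<open>v_x\<close>, which is free of
    \<open>u_tt\<close>, all other terms agree at the two points.\<close>
  have "Utx p * dd T q (v_x q) = Utx q * dd T q (v_x q)"
    using contact_relations(3)[OF p contact_v_x] contact_relations(3)[OF q contact_v_x]
    by (auto simp: vx dUx sb Uxx)
  moreover have "dd T q (v_x q) = dd T q e_x + co_ux q * dd T q e_u"
    using base_expand[OF base_fun(1) q, of "v_x q"] by (simp add: v_x_def)
  ultimately have Utx: "Utx p = Utx q" using nz by simp
  have dTvt: "dd T p (v_t p) = dd T q (v_t q)"
    by (rule factors_dd_eq[OF base_fun(1) linear_base_of p q b(1)]) (simp add: vt base_of_def e_defs prod_eq_iff)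
  have dXvt: "dd X p (v_t p) = 0" "dd X q (v_t q) = 0"
    using dd_X[OF p, of "v_t p"] dd_X[OF q, of "v_t q"] by (simp_all add: v_t_def)
  \<comment> \<open>Along \<open>v_t\<close> the shift of \<open>u_tt\<close> appears as a multiple
    of \<open>e_ut\<close>, so the derivative of \<open>Ux\<close> by \<open>u_t\<close> must
    vanish.\<close>
  have "dd Ux q (v_t q + s *\<^sub>R e_ut) = dd Ux q (v_t q)"
    using contact_relations(3)[OF p contact_v_t] contact_relations(3)[OF q contact_v_t]
    unfolding dUx dTvt dXvt Utx vt[symmetric] by simp
  then have Ux_ut: "dd Ux q e_ut = 0"
    using linear_add[OF linear_dd[OF smooth_comp(5) q], of "v_t q" "s *\<^sub>R e_ut"]
      linear_scale[OF linear_dd[OF smooth_comp(5) q], of s e_ut] s by simp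
  have be: "base_of e_ut = 0" by (simp add: base_of_def e_defs prod_eq_iff)
  have z: "dd (\<lambda>p. dd T p e) q e_ut = 0" "dd (\<lambda>p. dd X p e) q e_ut = 0" "dd (\<lambda>p. dd U p e) q e_ut = 0" for e
    by (rule factors_dd_zero[OF base_fun_dd(1) linear_base_of q be]
        factors_dd_zero[OF base_fun_dd(2) linear_base_of q be] factors_dd_zero[OF base_fun_dd(3) linear_base_of q be])+
  \<comment> \<open>Differentiating the prolongation formulas by \<open>u_t\<close> now gives zero
    for \<open>Ut\<close> too; then \<open>U_t\<close> and \<open>U_u\<close> are \<open>Ut\<close>
    times \<open>T_t\<close> and \<open>T_u\<close>.\<close>
  have "dd Ut q e_ut * (dd T q e_x + co_ux q * dd T q e_u) = 0"
    using first_prolongation_dd(2)[OF q, of e_ut] by (simp add: z Ux_ut) (simp add: e_defs)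
  then have "dd Ut q e_ut = 0" using nz by simp
  then have Uu: "dd U q e_u = Ut q * dd T q e_u"
    using first_prolongation_dd(1)[OF q, of e_ut] by (simp add: z) (simp add: e_defs)
  then have "dd U q e_t = Ut q * dd T q e_t"
    using first_prolongation(1)[OF q] by (simp add: algebra_simps)
  with Uu show False using jacobian_nonzero[OF q] by simp
qed

text \<open>Moving along an equation, \<open>u\<^sub>t\<close> is adjusted so that the point stays on it.\<close>

lemma on_equation_line:
  assumes q: "q \<in> D" and on: "on_equation q"
  obtains e where "e > 0" "\<And>s. \<bar>s\<bar> < e \<Longrightarrow> q + s *\<^sub>R (e_uxx + co_A q *\<^sub>R e_ut) \<in> D"
    "\<And>s. \<bar>s\<bar> < e \<Longrightarrow> q + s *\<^sub>R (e_ux + co_B q *\<^sub>R e_ut) \<in> D"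
    "\<And>s. \<bar>s\<bar> < e \<Longrightarrow> q + s *\<^sub>R (e_B + co_ux q *\<^sub>R e_ut) \<in> D"
    "\<And>s. on_equation (q + s *\<^sub>R (e_uxx + co_A q *\<^sub>R e_ut))"
    "\<And>s. on_equation (q + s *\<^sub>R (e_ux + co_B q *\<^sub>R e_ut))"
    "\<And>s. on_equation (q + s *\<^sub>R (e_B + co_ux q *\<^sub>R e_ut))"
proof -
  obtain e1 where e1: "e1 > 0" "\<And>s. \<bar>s\<bar> < e1 \<Longrightarrow> q + s *\<^sub>R (e_uxx + co_A q *\<^sub>R e_ut) \<in> D"
    using open_line_in[OF op q] by blast
  obtain e2 where e2: "e2 > 0" "\<And>s. \<bar>s\<bar> < e2 \<Longrightarrow> q + s *\<^sub>R (e_ux + co_B q *\<^sub>R e_ut) \<in> D"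
    using open_line_in[OF op q] by blast
  obtain e3 where e3: "e3 > 0" "\<And>s. \<bar>s\<bar> < e3 \<Longrightarrow> q + s *\<^sub>R (e_B + co_ux q *\<^sub>R e_ut) \<in> D"
    using open_line_in[OF op q] by blast
  show ?thesis
    by (rule that[of "min e1 (min e2 e3)"])
       (use e1 e2 e3 on in \<open>auto simp: on_equation_iff e_defs algebra_simps\<close>)
qed

text \<open>\<open>D_x T\<close> is affine in \<open>u_x\<close>, and two points of the equation
  over one base point with different \<open>u_x\<close> separate its coefficients.\<close>

lemma T_x_u_zero:
  assumes p: "p \<in> D" shows "dd T p e_x = 0" "dd T p e_u = 0"
proof -
  obtain q where q: "q \<in> D" "base_of q = base_of p" "on_equation q" using ex_on_equation[OF p] by metis
  obtain e where e: "e > 0" "\<And>s. \<bar>s\<bar> < e \<Longrightarrow> q + s *\<^sub>R (e_ux + co_B q *\<^sub>R e_ut) \<in> D"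
    "\<And>s. on_equation (q + s *\<^sub>R (e_ux + co_B q *\<^sub>R e_ut))"
    by (rule on_equation_line[OF q(1,3)]) blast
  define r where "r = q + (e/2) *\<^sub>R (e_ux + co_B q *\<^sub>R e_ut)"
  have r: "r \<in> D" "on_equation r" using e by (simp_all add: r_def)
  have "base_of r = base_of q" by (simp add: r_def base_of_def e_defs prod_eq_iff)
  note sb = same_base[OF r(1) q(1) this]
  have ux: "co_ux r = co_ux q + e / 2" by (simp add: r_def e_defs)
  have "(e / 2) * dd T q e_u = 0"
    using DxT_zero[OF r] DxT_zero[OF q(1,3)] unfolding sb ux distrib_right by linarith
  then have u: "dd T q e_u = 0" using e(1) by simp
  then have "dd T q e_x = 0" using DxT_zero[OF q(1,3)] by simp
  with u show "dd T p e_x = 0" "dd T p e_u = 0" using same_base[OF q(1) p q(2)] by simp_all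
qed

lemma dd_T: "p \<in> D \<Longrightarrow> dd T p v = co_t v * dd T p e_t"
  using base_expand[OF base_fun(1), of p v] T_x_u_zero by simp

lemma T_t_U_u_nonzero: assumes "p \<in> D" shows "dd T p e_t \<noteq> 0" "dd U p e_u \<noteq> 0"
  using jacobian_nonzero[OF assms] T_x_u_zero[OF assms] by auto

lemma Ut_Ux:
  assumes p: "p \<in> D"
  shows "dd T p e_t * Ut p = dd U p e_t + co_ut p * dd U p e_u"
    "dd X p e_x * Ux p = dd U p e_x + co_ux p * dd U p e_u"
  using first_prolongation[OF p] T_x_u_zero[OF p] by simp_all

section \<open>From vanishing derivatives to dependence on fewer variables\<close>

lemma x_fibre_constant:
  assumes f: "factors_through base_of f" and z: "\<And>p. p \<in> D \<Longrightarrow> dd f p e_t = 0" "\<And>p. p \<in> D \<Longrightarrow> dd f p e_u = (0::real)"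
  shows "factors_through x_of f"
  unfolding factors_through_def
proof (intro conjI ballI impI)
  show "smooth_on D f" by (rule factors_throughD(1)[OF f])
  fix p q assume pq: "p \<in> D" "q \<in> D" "x_of p = x_of q"
  define x where "x = x_of p"
  define S where "S = {(t, u). (t, x, u) \<in> base_of ` D}"
  have S: "S = (\<lambda>b. (fst b, x, snd b)) -` (base_of ` D)" by (auto simp: S_def)
  \<comment> \<open>The parameters are \<open>(t, u)\<close> at fixed \<open>x\<close>, so
    connectedness of the sections of the base domain enters here.\<close>
  show "f p = f q"
  proof (rule constant_on_sections[where \<sigma>="\<lambda>h. ((fst h, 0, snd h), 0)" and R="\<lambda>b p. base_of p = (fst b, x, snd b)" and S=S])
    show "open D" "smooth_on D f" using op factors_throughD(1)[OF f] by auto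
    show "open S" unfolding S
      using local_domain_projections(2)[OF D] by (intro open_vimage) (auto intro!: continuous_intros)
    show "connected S" using D by (auto simp: S_def local_domain_def)
    show "\<exists>p\<in>D. base_of p = (fst b, x, snd b)" if "b \<in> S" for b
      using that by (force simp: S)
    show "f p = f q" if "p \<in> D" "q \<in> D" "base_of p = (fst b, x, snd b)" "base_of q = (fst b, x, snd b)" for b p q
      using factors_throughD(2)[OF f that(1,2)] that by simp
    show "linear (\<lambda>h::real \<times> real. ((fst h, 0, snd h), 0) :: espace)"
      by (auto intro!: linearI simp: prod_eq_iff)
    show "base_of (p + ((fst h, 0, snd h), 0)) = (fst (b + h), x, snd (b + h))" if "base_of p = (fst b, x, snd b)" for b h p
      using that by (simp add: base_of_def)
    show "dd f p ((fst h, 0, snd h), 0) = 0" if "p \<in> D" for p h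
      using base_expand[OF f that, of "((fst h, 0, snd h), 0)"] z[OF that] by simp
    show "p \<in> D" "q \<in> D" by fact+
    show "base_of p = (fst (co_t p, co_u p), x, snd (co_t p, co_u p))"
      "base_of q = (fst (co_t q, co_u q), x, snd (co_t q, co_u q))"
      using pq by (simp_all add: x_def x_of_def base_of_def prod_eq_iff)
    then show "(co_t p, co_u p) \<in> S" "(co_t q, co_u q) \<in> S"
      using pq by (auto simp: S image_iff) metis+
  qed
qed

lemma base_constant:
  fixes f :: "espace \<Rightarrow> real"
  assumes f: "factors_through base_of f"
    and z: "\<And>p. p \<in> D \<Longrightarrow> dd f p e_t = 0" "\<And>p. p \<in> D \<Longrightarrow> dd f p e_x = 0" "\<And>p. p \<in> D \<Longrightarrow> dd f p e_u = 0"
    and pq: "p \<in> D" "q \<in> D"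
  shows "f p = f q"
proof (rule constant_on_sections[where \<sigma>="\<lambda>h. (h, 0)" and R="\<lambda>b p. base_of p = b" and S="base_of ` D"])
  show "open D" "smooth_on D f" using op factors_throughD(1)[OF f] by auto
  show "open (base_of ` D)" "connected (base_of ` D)" using local_domain_projections[OF D] by auto
  show "f p = f q" if "p \<in> D" "q \<in> D" "base_of p = b" "base_of q = b" for b p q
    using factors_throughD(2)[OF f that(1,2)] that by simp
  show "linear (\<lambda>h. (h, 0) :: espace)" by (auto intro!: linearI simp: prod_eq_iff)
  show "dd f p (h, 0) = 0" if "p \<in> D" for p h
    using base_expand[OF f that, of "(h, 0)"] z[OF that] by simp
  show "\<exists>p\<in>D. base_of p = b" if "b \<in> base_of ` D" for b using that by blast
  show "base_of (p + (h, 0)) = b + h" if "base_of p = b" for b h p using that by (simp add: base_of_def)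
qed (use pq in auto)

end

section \<open>Determining equations\<close>

text \<open>Coefficients of the determining equation, a polynomial in \<open>x = u\<^sub>x\<close> and \<open>m = u\<^sub>x\<^sub>x\<close>.\<close>

lemma determining_polynomial:
  fixes F :: "real \<Rightarrow> real \<Rightarrow> real" and A k k2 t u :: real
  assumes F_def: "F = (\<lambda>x m. k^3 * (u0 + (a * m + b * x) * u)
      - (t * A * (k * (P + x * K + x^2 * R + m * u) - k2 * (c + x * u)) + t * B * k^2 * (c + x * u)))"
    and nz: "A \<noteq> 0" "k \<noteq> 0" "t \<noteq> 0" "u \<noteq> 0" "s \<noteq> 0"
    and F: "F x m = 0" "F x (m + s) = 0" "F (x + s) m = 0" "F (x - s) m = 0"
  shows "R = 0" "k^2 * a = t * A" "k * b * u = a * (k * K - k2 * u) + t * B * u"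
    "u0 * u = a * P * u + b * c * u - a * K * c"
proof -
  \<comment> \<open>The values of \<open>F\<close> are known at four arguments only, so coefficients
    are extracted by finite differences: a first difference in \<open>m\<close>, then a second and a
    central difference in \<open>x\<close>.\<close>
  have "F x (m + s) - F x m = k * s * u * (k^2 * a - t * A)"
    by (simp add: F_def algebra_simps power2_eq_square power3_eq_cube)
  then show 1: "k^2 * a = t * A" using F nz by simp
  have "F (x + s) m + F (x - s) m - 2 * F x m = - 2 * s^2 * t * A * k * R"
    by (simp add: F_def algebra_simps power2_eq_square power3_eq_cube)
  then show R: "R = 0" using F nz by simp
  have "F (x + s) m - F (x - s) m = 2 * s * (k^3 * b * u - t * A * (k * K - k2 * u) - t * B * k^2 * u)"
    by (simp add: F_def R algebra_simps power2_eq_square power3_eq_cube)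
  then have "k^3 * b * u - t * A * (k * K - k2 * u) - t * B * k^2 * u = 0" using F nz by simp
  then have "k^2 * (k * b * u - (a * (k * K - k2 * u) + t * B * u)) = 0"
    unfolding 1[symmetric] by (simp add: algebra_simps power2_eq_square power3_eq_cube)
  then show 2: "k * b * u = a * (k * K - k2 * u) + t * B * u" using nz by simp
  have "F x m = k^2 * (k * (u0 + (a * m + b * x) * u) - a * (k * (P + x * K + m * u) - k2 * (c + x * u)) - t * B * (c + x * u))"
    unfolding F_def 1[symmetric] R by (simp add: algebra_simps power2_eq_square power3_eq_cube)
  then have 3: "k * (u0 + (a * m + b * x) * u) - a * (k * (P + x * K + m * u) - k2 * (c + x * u)) - t * B * (c + x * u) = 0"
    using F nz by simp
  \<comment> \<open>The multipliers \<open>u\<close> and \<open>c + x * u\<close> are chosen so that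
    the terms with the new coefficient \<open>B\<close> cancel.\<close>
  have "k * (u0 * u - (a * P * u + b * c * u - a * K * c))
    = u * (k * (u0 + (a * m + b * x) * u) - a * (k * (P + x * K + m * u) - k2 * (c + x * u)) - t * B * (c + x * u))
      - (c + x * u) * (k * b * u - (a * (k * K - k2 * u) + t * B * u))"
    by (simp add: algebra_simps)
  also have "\<dots> = 0" using 2 3 by simp
  finally show "u0 * u = a * P * u + b * c * u - a * K * c" using nz by simp
qed

section \<open>Second prolongation and comparison of coefficients\<close>

context equiv_transf begin

abbreviation "X_x p \<equiv> dd X p e_x"
abbreviation "X_xx p \<equiv> dd (\<lambda>p. dd X p e_x) p e_x"
abbreviation "T_t p \<equiv> dd T p e_t"
abbreviation "U_t p \<equiv> dd U p e_t"
abbreviation "U_x p \<equiv> dd U p e_x"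
abbreviation "U_u p \<equiv> dd U p e_u"
text \<open>The two orders of differentiation appear separately, as the product rule delivers them;
  \<open>U_x = 0\<close> later makes each vanish.\<close>

abbreviation "U_mix p \<equiv> dd (\<lambda>p. dd U p e_x) p e_u + dd (\<lambda>p. dd U p e_u) p e_x"
abbreviation "U_xx p \<equiv> dd (\<lambda>p. dd U p e_x) p e_x"
abbreviation "U_uu p \<equiv> dd (\<lambda>p. dd U p e_u) p e_u"

lemma X_fun: "factors_through x_of X" "factors_through x_of (\<lambda>p. X_x p)"
proof -
  show "factors_through x_of X" by (rule x_fibre_constant[OF base_fun(2) X_t_u_zero])
  then show "factors_through x_of (\<lambda>p. X_x p)" by (rule factors_dd[OF _ linear_x_of])
qed

lemma x_expand:
  fixes f :: "espace \<Rightarrow> real"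
  assumes f: "factors_through x_of f" and p: "p \<in> D"
  shows "dd f p v = co_x v * dd f p e_x"
proof -
  have "dd f p v = dd f p (co_x v *\<^sub>R e_x)"
    by (rule factors_dd_eq[OF f linear_x_of p p refl]) (simp add: x_of_def base_of_def e_defs)
  then show ?thesis using linear_scale[OF linear_dd[OF factors_throughD(1)[OF f] p]] by simp
qed

lemma dd_zero_fun:
  fixes f :: "espace \<Rightarrow> real"
  assumes "\<And>q. q \<in> D \<Longrightarrow> f q = 0" "p \<in> D"
  shows "dd f p v = 0"
proof -
  have "(f has_derivative (\<lambda>v. 0)) (at p)"
    by (rule has_derivative_transform_within_open[OF has_derivative_const[of 0] op assms(2)]) (simp add: assms(1))
  then show ?thesis by (rule dd_eqI)
qed

lemma v_x_simps: "co_t (v_x p) = 0" "co_x (v_x p) = 1" "co_u (v_x p) = co_ux p" "co_ut (v_x p) = co_utx p"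
  "co_ux (v_x p) = co_uxx p"
  by (simp_all add: v_x_def)

text \<open>The second prolongation: differentiating the formula for \<open>Ux\<close> along the
  total derivative gives \<open>D_x\<close> applied twice to \<open>U\<close>, with
  \<open>X_xx\<close> stemming from the factor \<open>X_x\<close>.\<close>

lemma Uxx_relation:
  assumes p: "p \<in> D"
  shows "(X_x p)^2 * Uxx p + X_xx p * Ux p = U_xx p + co_ux p * U_mix p + (co_ux p)^2 * U_uu p + co_uxx p * U_u p"
proof -
  have T0: "dd (\<lambda>p. dd T p e_x) p v = 0" "dd (\<lambda>p. dd T p e_u) p v = 0" for v
    by (rule dd_zero_fun[OF _ p]; simp add: T_x_u_zero)+
  have "dd Ux p (v_x p) = Uxx p * X_x p"
    using contact_relations(3)[OF p contact_v_x] dd_T[OF p, of "v_x p"] dd_X[OF p, of "v_x p"]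
    by (simp add: v_x_simps)
  moreover have "dd (\<lambda>p. dd X p e_x) p (v_x p) = X_xx p"
    using x_expand[OF X_fun(2) p, of "v_x p"] by (simp add: v_x_simps)
  moreover have "dd (\<lambda>p. dd U p e) p (v_x p) = dd (\<lambda>p. dd U p e) p e_x + co_ux p * dd (\<lambda>p. dd U p e) p e_u" for e
    using base_expand[OF base_fun_dd(3) p, of e "v_x p"] by (simp add: v_x_simps)
  ultimately show ?thesis
    using first_prolongation_dd(2)[OF p, of "v_x p"] T_x_u_zero[OF p]
    by (simp add: T0 v_x_simps algebra_simps power2_eq_square)
qed

text \<open>The residual of the transformed equation times \<open>T_t X_x^3\<close>, with the new
  derivatives eliminated and \<open>u_t\<close> expressed by the old equation. The arguments stand
  for \<open>u_x\<close> and \<open>u_xx\<close>; everything else depends on the base point and the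
  coefficients.\<close>

definition determining :: "espace \<Rightarrow> real \<Rightarrow> real \<Rightarrow> real" where
  "determining p = (\<lambda>x m. (X_x p)^3 * (U_t p + (co_A p * m + co_B p * x) * U_u p)
      - (T_t p * Ac p * (X_x p * (U_xx p + x * U_mix p + x^2 * U_uu p + m * U_u p) - X_xx p * (U_x p + x * U_u p))
         + T_t p * Bc p * (X_x p)^2 * (U_x p + x * U_u p)))"

lemma determining_zero:
  assumes p: "p \<in> D" and on: "on_equation p"
  shows "determining p (co_ux p) (co_uxx p) = 0"
proof -
  define W where "W = U_xx p + co_ux p * U_mix p + (co_ux p)^2 * U_uu p + co_uxx p * U_u p"
  have W: "(X_x p)^2 * Uxx p = W - X_xx p * Ux p" using Uxx_relation[OF p] by (simp add: W_def)
  have "(X_x p)^3 * (U_t p + co_ut p * U_u p) = (X_x p)^3 * (T_t p * (Ac p * Uxx p + Bc p * Ux p))"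
    using Ut_Ux(1)[OF p] on_equation_image(2)[OF p on] by simp
  also have "\<dots> = T_t p * Ac p * (X_x p * ((X_x p)^2 * Uxx p)) + T_t p * Bc p * (X_x p)^2 * (X_x p * Ux p)"
    by (simp add: algebra_simps power2_eq_square power3_eq_cube)
  also have "\<dots> = T_t p * Ac p * (X_x p * W - X_xx p * (X_x p * Ux p)) + T_t p * Bc p * (X_x p)^2 * (X_x p * Ux p)"
    unfolding W by (simp add: algebra_simps)
  finally show ?thesis
    using on unfolding Ut_Ux(2)[OF p] by (simp add: determining_def W_def on_equation_iff)
qed

lemma determining_cong:
  assumes "p \<in> D" "q \<in> D" "base_of p = base_of q" "coeffs_of p = coeffs_of q"
  shows "determining p = determining q"
proof -
  note sb = same_base[OF assms(1-3)]
  have 2: "dd (\<lambda>p. dd U p e) p e' = dd (\<lambda>p. dd U p e) q e'" "dd (\<lambda>p. dd X p e) p e' = dd (\<lambda>p. dd X p e) q e'" for e e'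
    by (rule factors_dd_eq[OF base_fun_dd(3) linear_base_of assms(1-3) refl]
        factors_dd_eq[OF base_fun_dd(2) linear_base_of assms(1-3) refl])+
  have "co_A p = co_A q" "co_B p = co_B q" using assms(4) by (simp_all add: coeffs_of_def prod_eq_iff)
  then show ?thesis
    unfolding determining_def sb 2 coeffs_same[OF assms(1,2) sb(1) assms(4)] by simp
qed

text \<open>Moving along the equation over a fixed base point and fixed coefficients changes only
  the arguments of the polynomial, which provides the four zeros needed to compare
  coefficients.\<close>

lemma determining_equations:
  assumes q: "q \<in> D" and on: "on_equation q"
  shows "U_uu q = 0" "(X_x q)^2 * co_A q = T_t q * Ac q"
    "X_x q * co_B q * U_u q = co_A q * (X_x q * U_mix q - X_xx q * U_u q) + T_t q * Bc q * U_u q"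
    "U_t q * U_u q = co_A q * U_xx q * U_u q + co_B q * U_x q * U_u q - co_A q * U_mix q * U_x q"
proof -
  obtain e where e: "e > 0" "\<And>s. \<bar>s\<bar> < e \<Longrightarrow> q + s *\<^sub>R (e_uxx + co_A q *\<^sub>R e_ut) \<in> D"
    "\<And>s. \<bar>s\<bar> < e \<Longrightarrow> q + s *\<^sub>R (e_ux + co_B q *\<^sub>R e_ut) \<in> D"
    "\<And>s. on_equation (q + s *\<^sub>R (e_uxx + co_A q *\<^sub>R e_ut))"
    "\<And>s. on_equation (q + s *\<^sub>R (e_ux + co_B q *\<^sub>R e_ut))"
    by (rule on_equation_line[OF q on]) blast
  have moved: "determining q (co_ux r) (co_uxx r) = 0"
    if "r \<in> D" "on_equation r" "base_of r = base_of q" "coeffs_of r = coeffs_of q" for r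
    using determining_zero[OF that(1,2)] determining_cong[OF that(1) q that(3,4)] by simp
  define s where "s = e / 2"
  have s: "s \<noteq> 0" "\<bar>s\<bar> < e" "\<bar>-s\<bar> < e" using e(1) by (auto simp: s_def)
  have 1: "determining q (co_ux q) (co_uxx q) = 0" using determining_zero[OF q on] .
  have 2: "determining q (co_ux q) (co_uxx q + s) = 0"
    using moved[OF e(2)[OF s(2)] e(4)] by (simp add: e_defs base_of_def coeffs_of_def prod_eq_iff)
  have 3: "determining q (co_ux q + s) (co_uxx q) = 0"
    using moved[OF e(3)[OF s(2)] e(5)] by (simp add: e_defs base_of_def coeffs_of_def prod_eq_iff)
  have 4: "determining q (co_ux q - s) (co_uxx q) = 0"
    using moved[OF e(3)[OF s(3)] e(5)] by (simp add: e_defs base_of_def coeffs_of_def prod_eq_iff)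
  note * = determining_polynomial[OF determining_def on_equation_image(1)[OF q on] X_x_nonzero[OF q]
      T_t_U_u_nonzero[OF q] s(1) 1 2 3 4]
  show "U_uu q = 0" "(X_x q)^2 * co_A q = T_t q * Ac q"
    "X_x q * co_B q * U_u q = co_A q * (X_x q * U_mix q - X_xx q * U_u q) + T_t q * Bc q * U_u q"
    "U_t q * U_u q = co_A q * U_xx q * U_u q + co_B q * U_x q * U_u q - co_A q * U_mix q * U_x q"
    by (fact *)+
qed

text \<open>The last determining equation is affine in \<open>B\<close> with coefficient
  \<open>U_x U_u\<close>, and its other terms are free of \<open>B\<close>; moving \<open>B\<close>
  within the equation annihilates that coefficient.\<close>

lemma U_x_zero_on_equation:
  assumes q: "q \<in> D" and on: "on_equation q" shows "U_x q = 0"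
proof -
  obtain e where e: "e > 0" "\<And>s. \<bar>s\<bar> < e \<Longrightarrow> q + s *\<^sub>R (e_B + co_ux q *\<^sub>R e_ut) \<in> D"
    "\<And>s. on_equation (q + s *\<^sub>R (e_B + co_ux q *\<^sub>R e_ut))"
    by (rule on_equation_line[OF q on]) blast
  define r where "r = q + (e/2) *\<^sub>R (e_B + co_ux q *\<^sub>R e_ut)"
  have r: "r \<in> D" "on_equation r" using e by (simp_all add: r_def)
  have b: "base_of r = base_of q" by (simp add: r_def base_of_def e_defs prod_eq_iff)
  have AB: "co_A r = co_A q" "co_B r = co_B q + e / 2" by (simp_all add: r_def e_defs)
  note sb = same_base[OF r(1) q b]
  have 2: "dd (\<lambda>p. dd U p e) r e' = dd (\<lambda>p. dd U p e) q e'" for e e'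
    by (rule factors_dd_eq[OF base_fun_dd(3) linear_base_of r(1) q b refl])
  have "(e / 2) * U_x q * U_u q = 0"
    using determining_equations(4)[OF r] determining_equations(4)[OF q on]
    unfolding sb AB 2 by (simp add: algebra_simps)
  then show ?thesis using e(1) T_t_U_u_nonzero[OF q] by simp
qed

lemma U_x_zero: assumes p: "p \<in> D" shows "U_x p = 0"
proof -
  obtain q where "q \<in> D" "base_of q = base_of p" "on_equation q" using ex_on_equation[OF p] by metis
  then show ?thesis using U_x_zero_on_equation same_base(4)[OF _ p] by metis
qed

lemma U_mixed_zero:
  assumes p: "p \<in> D" shows "U_xx p = 0" "dd (\<lambda>p. dd U p e_x) p e_u = 0" "dd (\<lambda>p. dd U p e_u) p e_x = 0"
proof -
  show "U_xx p = 0" by (rule dd_zero_fun[OF U_x_zero p])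
  show "dd (\<lambda>p. dd U p e_x) p e_u = 0" by (rule dd_zero_fun[OF U_x_zero p])
  show "dd (\<lambda>p. dd U p e_u) p e_x = 0" by (rule dd_dd_zero[OF op smooth_comp(3) U_x_zero p])
qed

text \<open>With \<open>U_x = 0\<close> the right-hand side of the last determining equation
  vanishes, leaving \<open>U_t U_u = 0\<close>.\<close>

lemma U_t_zero: assumes p: "p \<in> D" shows "U_t p = 0"
proof -
  obtain q where q: "q \<in> D" "base_of q = base_of p" "on_equation q" using ex_on_equation[OF p] by metis
  have "U_t q * U_u q = 0"
    using determining_equations(4)[OF q(1,3)] U_x_zero[OF q(1)] U_mixed_zero[OF q(1)] by simp
  then show ?thesis using T_t_U_u_nonzero[OF q(1)] same_base(4)[OF q(1) p q(2)] by simp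
qed

lemma U_uu_zero: assumes p: "p \<in> D" shows "U_uu p = 0"
proof -
  obtain q where q: "q \<in> D" "base_of q = base_of p" "on_equation q" using ex_on_equation[OF p] by metis
  have "dd (\<lambda>p. dd U p e_u) q e_u = dd (\<lambda>p. dd U p e_u) p e_u"
    by (rule factors_dd_eq[OF base_fun_dd(3) linear_base_of q(1) p q(2) refl])
  then show ?thesis using determining_equations(1)[OF q(1,3)] by simp
qed

lemma U_u_constant: "p \<in> D \<Longrightarrow> q \<in> D \<Longrightarrow> U_u p = U_u q"
  by (rule base_constant[OF base_fun_dd(3) dd_dd_zero[OF op smooth_comp(3) U_t_zero] U_mixed_zero(3) U_uu_zero])

text \<open>Transfer to jets off the equation: both sides depend on the base point and the
  coefficients only, so a point of the equation with the same data decides.\<close>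

lemma Ac_Bc:
  assumes p: "p \<in> D"
  shows "T_t p * Ac p = (X_x p)^2 * co_A p" "T_t p * Bc p = X_x p * co_B p + X_xx p * co_A p"
proof -
  obtain q where q: "q \<in> D" "base_of q = base_of p" "coeffs_of q = coeffs_of p" "on_equation q"
    using ex_on_equation[OF p] by metis
  note sb = same_base[OF q(1) p q(2)]
  note cs = coeffs_same[OF q(1) p sb(1) q(3)]
  have AB: "co_A q = co_A p" "co_B q = co_B p" using q(3) by (simp_all add: coeffs_of_def prod_eq_iff)
  have xx: "X_xx q = X_xx p"
    by (rule factors_dd_eq[OF base_fun_dd(2) linear_base_of q(1) p q(2) refl])
  show "T_t p * Ac p = (X_x p)^2 * co_A p"
    using determining_equations(2)[OF q(1,4)] unfolding sb cs AB by simp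
  have "(X_x p * co_B p) * U_u p = (T_t p * Bc p - X_xx p * co_A p) * U_u p"
    using determining_equations(3)[OF q(1,4)] U_mixed_zero[OF q(1)] unfolding sb cs AB xx
    by (simp add: algebra_simps)
  then show "T_t p * Bc p = X_x p * co_B p + X_xx p * co_A p"
    using T_t_U_u_nonzero[OF p] by simp
qed

text \<open>\<open>T_t\<close> is determined by \<open>T_t Ac = X_x^2 A\<close>: points with equal
  \<open>x\<close> have equal \<open>X\<close>, and with equal coefficients also equal
  \<open>Ac\<close>, whatever their \<open>t\<close>.\<close>

lemma T_t_fun: "factors_through (\<lambda>p. (x_of p, coeffs_of p)) (\<lambda>p. T_t p)"
  unfolding factors_through_def
proof (intro conjI ballI impI)
  show "smooth_on D (\<lambda>p. T_t p)" by (rule smooth_on_frechet_derivative[OF smooth_comp(1)])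
  fix p q assume pq: "p \<in> D" "q \<in> D" "(x_of p, coeffs_of p) = (x_of q, coeffs_of q)"
  then have "x_of p = x_of q" by simp
  note X = X_fun[THEN factors_throughD(2), OF pq(1,2) this]
  have "Ac p = Ac q" "co_A p = co_A q" using coeffs_same(1)[OF pq(1,2) X(1)] pq(3) by (simp_all add: coeffs_of_def prod_eq_iff)
  moreover have "co_A q \<noteq> 0" using D pq(2) by (auto simp: local_domain_def coeffs_of_def)
  ultimately have "T_t p * Ac q = T_t q * Ac q" "Ac q \<noteq> 0"
    using Ac_Bc(1)[OF pq(1)] Ac_Bc(1)[OF pq(2)] X X_x_nonzero[OF pq(2)] by auto
  then show "T_t p = T_t q" by simp
qed

text \<open>Motion in \<open>t\<close> or \<open>u\<close> fixes \<open>x\<close> and the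
  coefficients, and the \<open>x\<close>-derivative of \<open>T_t\<close> is a mixed derivative that
  vanishes because \<open>T_x = 0\<close>.\<close>

lemma T_t_constant: "p \<in> D \<Longrightarrow> q \<in> D \<Longrightarrow> T_t p = T_t q"
proof (rule base_constant[OF base_fun_dd(1)])
  have lin: "linear (\<lambda>p. (x_of p, coeffs_of p))"
    by (auto intro!: linearI simp: x_of_def base_of_def coeffs_of_def)
  show "dd (\<lambda>p. T_t p) p e_t = 0" "dd (\<lambda>p. T_t p) p e_u = 0" if "p \<in> D" for p
    by (rule factors_dd_zero[OF T_t_fun lin that]; simp add: x_of_def base_of_def coeffs_of_def e_defs prod_eq_iff)+
  show "dd (\<lambda>p. T_t p) p e_x = 0" if "p \<in> D" for p
    by (rule dd_dd_zero[OF op smooth_comp(1) T_x_u_zero(1) that])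
qed

section \<open>Integration to the finite form of the transformation\<close>

lemma affine:
  assumes f: "factors_through base_of f" and c: "linear c" "factors_through base_of c"
    and eq: "\<And>p. p \<in> D \<Longrightarrow> dd f p e_t = k * c e_t" "\<And>p. p \<in> D \<Longrightarrow> dd f p e_x = k * c e_x"
      "\<And>p. p \<in> D \<Longrightarrow> dd f p e_u = k * c e_u"
  shows "\<exists>d. \<forall>p\<in>D. f p = k * c p + (d::real)"
proof (cases "D = {}")
  case False
  then obtain q where q: "q \<in> D" by auto
  define g where "g p = f p - k * c p" for p
  have g: "factors_through base_of g"
    unfolding factors_through_def
  proof (intro conjI ballI impI)
    show "smooth_on D g" unfolding g_def by (intro smooth_intros op factors_throughD(1)[OF f] factors_throughD(1)[OF c(2)])
    show "g p = g q" if "p \<in> D" "q \<in> D" "base_of p = base_of q" for p q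
      unfolding g_def factors_throughD(2)[OF f that] factors_throughD(2)[OF c(2) that] ..
  qed
  have dg: "dd g p v = dd f p v - k * c v" if "p \<in> D" for p v
  proof (rule dd_eqI)
    have "(c has_derivative c) (at p)" using c(1) linear_imp_has_derivative by blast
    then show "(g has_derivative (\<lambda>v. dd f p v - k * c v)) (at p)"
      unfolding g_def using smooth_on_has_derivative[OF factors_throughD(1)[OF f] that]
      by (intro has_derivative_diff has_derivative_mult_right)
  qed
  have "f p = k * c p + g q" if "p \<in> D" for p
  proof -
    have "g p = g q" by (rule base_constant[OF g _ _ _ that q]) (simp_all add: dg eq)
    then show ?thesis using g_def[of p] by simp
  qed
  then show ?thesis by blast
qed auto

text \<open>The value of \<open>h\<close> is read at an arbitrarily chosen point over
  \<open>x\<close>; near the projection of a given point of \<open>D\<close>, \<open>h\<close> is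
  \<open>f\<close> along the line through that point in direction \<open>e_x\<close>, which yields
  smoothness and the derivative.\<close>

lemma x_function:
  fixes f :: "espace \<Rightarrow> real"
  assumes f: "factors_through x_of f"
  obtains h where "smooth_on (x_of ` D) h" "\<And>p. p \<in> D \<Longrightarrow> h (x_of p) = f p"
    "\<And>p. p \<in> D \<Longrightarrow> deriv h (x_of p) = dd f p e_x"
proof -
  define h where "h x = f (SOME p. p \<in> D \<and> x_of p = x)" for x
  have h: "h (x_of p) = f p" if "p \<in> D" for p
  proof -
    have "(SOME q. q \<in> D \<and> x_of q = x_of p) \<in> D \<and> x_of (SOME q. q \<in> D \<and> x_of q = x_of p) = x_of p"
      by (rule someI[of _ p]) (simp add: that)
    then show ?thesis unfolding h_def using factors_throughD(2)[OF f _ that] by blast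
  qed
  have local: "\<exists>N. open N \<and> x_of p \<in> N \<and> smooth_on N h \<and> (h has_real_derivative dd f p e_x) (at (x_of p))"
    if p: "p \<in> D" for p
  proof -
    define L where "L y = (p - x_of p *\<^sub>R e_x) + y *\<^sub>R e_x" for y :: real
    define N where "N = L -` D"
    have N: "open N" unfolding N_def L_def using op by (intro open_vimage) (auto intro!: continuous_intros)
    have L0: "L (x_of p) = p" by (simp add: L_def)
    have "x_of (L y) = y" for y by (simp add: L_def x_of_def base_of_def e_defs)
    then have hL: "f (L y) = h y" if "y \<in> N" for y using h[of "L y"] that by (simp add: N_def)
    have "bounded_linear (\<lambda>y::real. y *\<^sub>R e_x)" by (rule bounded_linear_scaleR_left)
    then have "smooth_on N L" unfolding L_def
      by (intro smooth_on_add smooth_on_const smooth_on_bounded_linear N)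
    then have "smooth_on N (\<lambda>y. f (L y))"
      by (intro smooth_on_compose[OF factors_throughD(1)[OF f] N op]) (auto simp: N_def)
    then have "smooth_on N h" using smooth_on_cong[OF N, of "\<lambda>y. f (L y)" h] hL by blast
    moreover have "x_of p \<in> N" using p L0 by (simp add: N_def)
    moreover have "(h has_real_derivative dd f p e_x) (at (x_of p))"
    proof -
      have "(L has_derivative (\<lambda>y. y *\<^sub>R e_x)) (at (x_of p))"
        unfolding L_def by (auto intro!: derivative_eq_intros)
      moreover have "(f has_derivative dd f p) (at (L (x_of p)))"
        unfolding L0 by (rule smooth_on_has_derivative[OF factors_throughD(1)[OF f] p])
      ultimately have "((\<lambda>y. f (L y)) has_derivative (\<lambda>y. dd f p (y *\<^sub>R e_x))) (at (x_of p))"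
        by (rule has_derivative_compose)
      moreover have "(\<lambda>y. dd f p (y *\<^sub>R e_x)) = (*) (dd f p e_x)"
        using linear_scale[OF linear_dd[OF factors_throughD(1)[OF f] p]] by (auto simp: fun_eq_iff)
      ultimately have "((\<lambda>y. f (L y)) has_real_derivative dd f p e_x) (at (x_of p))"
        by (simp add: has_field_derivative_def)
      then show ?thesis
        by (rule has_field_derivative_transform_within_open[OF _ N \<open>x_of p \<in> N\<close> hL])
    qed
    ultimately show ?thesis using N by blast
  qed
  show ?thesis
  proof (rule that)
    show "smooth_on (x_of ` D) h"
    proof (rule smooth_on_locally)
      fix x assume "x \<in> x_of ` D"
      then obtain p where "p \<in> D" "x = x_of p" by blast
      then show "\<exists>N. open N \<and> x \<in> N \<and> smooth_on N h" using local[of p] by blast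
    qed
    show "deriv h (x_of p) = dd f p e_x" if "p \<in> D" for p using local[OF that] DERIV_imp_deriv by blast
  qed (fact h)
qed

lemma is_prolonged_transf:
  assumes q: "q \<in> D"
  obtains c1 c2 c3 c4 h where "c1 * c3 \<noteq> 0" "smooth_on (x_of ` D) h"
    "\<And>x. x \<in> x_of ` D \<Longrightarrow> deriv h x \<noteq> 0" "\<And>p. p \<in> D \<Longrightarrow> \<Phi> p = prolonged_transf c1 c2 c3 c4 h p"
proof -
  define c1 c3 where "c1 = T_t q" and "c3 = U_u q"
  have c: "c1 \<noteq> 0" "c3 \<noteq> 0" using T_t_U_u_nonzero[OF q] by (simp_all add: c1_def c3_def)
  have T_t: "T_t p = c1" and U_u: "U_u p = c3" if "p \<in> D" for p
    using T_t_constant[OF that q] U_u_constant[OF that q] by (simp_all add: c1_def c3_def)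
  have lin: "linear co_t" "linear co_u" using bounded_linear_co linear_conv_bounded_linear by blast+
  have co: "factors_through base_of co_t" "factors_through base_of co_u"
    using smooth_on_bounded_linear[OF bounded_linear_co(1) op] smooth_on_bounded_linear[OF bounded_linear_co(3) op]
    by (simp_all add: factors_through_def base_of_def)
  obtain c2 where T: "\<And>p. p \<in> D \<Longrightarrow> T p = c1 * co_t p + c2"
    using affine[OF base_fun(1) lin(1) co(1), of c1] T_t T_x_u_zero by (auto simp: e_defs)
  obtain c4 where U: "\<And>p. p \<in> D \<Longrightarrow> U p = c3 * co_u p + c4"
    using affine[OF base_fun(3) lin(2) co(2), of c3] U_u U_t_zero U_x_zero by (auto simp: e_defs)
  obtain h where h: "smooth_on (x_of ` D) h" "\<And>p. p \<in> D \<Longrightarrow> h (x_of p) = X p"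
    "\<And>p. p \<in> D \<Longrightarrow> deriv h (x_of p) = X_x p"
    by (rule x_function[OF X_fun(1)]) blast
  \<comment> \<open>A second function represents \<open>X_x\<close>. It agrees with
    \<open>deriv h\<close> on the open projection of \<open>D\<close>, so its derivative identifies
    \<open>deriv (deriv h)\<close> with \<open>X_xx\<close>.\<close>
  obtain h' where h': "smooth_on (x_of ` D) h'" "\<And>p. p \<in> D \<Longrightarrow> h' (x_of p) = X_x p"
    "\<And>p. p \<in> D \<Longrightarrow> deriv h' (x_of p) = X_xx p"
    by (rule x_function[OF X_fun(2)]) blast
  have hh': "h' x = deriv h x" if "x \<in> x_of ` D" for x using that h(3) h'(2) by auto
  have X_xx: "deriv (deriv h) (x_of p) = X_xx p" if p: "p \<in> D" for p
  proof -
    have xp: "x_of p \<in> x_of ` D" using p by simp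
    have "(deriv h has_real_derivative deriv h' (x_of p)) (at (x_of p))"
      by (rule has_field_derivative_transform_within_open[OF smooth_on_DERIV[OF h'(1) xp]
            local_domain_projections(3)[OF D] xp hh'])
    then show ?thesis using DERIV_imp_deriv h'(3)[OF p] by metis
  qed
  have Ut: "Ut p = c3 / c1 * co_ut p" if "p \<in> D" for p
    using Ut_Ux(1)[OF that] c by (simp add: T_t[OF that] U_u[OF that] U_t_zero[OF that] field_simps)
  \<comment> \<open>Prepares \<open>Utt\<close> and \<open>Utx\<close>, which are read off the
    second contact relation.\<close>
  have dUt: "dd Ut p v = c3 / c1 * co_ut v" if p: "p \<in> D" for p v
    by (rule has_derivative_unique_on_open[OF op p Ut smooth_on_has_derivative[OF smooth_comp(4) p]
          has_derivative_mult_right[OF bounded_linear_imp_has_derivative[OF bounded_linear_co(4)]]])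
  show ?thesis
  proof (rule that[of c1 c3 h c2 c4])
    show "c1 * c3 \<noteq> 0" using c by simp
    show "smooth_on (x_of ` D) h" by fact
    show "deriv h x \<noteq> 0" if "x \<in> x_of ` D" for x using that h(3) X_x_nonzero by auto
    fix p assume p: "p \<in> D"
    have X_x: "X_x p \<noteq> 0" by (rule X_x_nonzero[OF p])
    have Ux: "Ux p = c3 / X_x p * co_ux p"
      using Ut_Ux(2)[OF p] X_x by (simp add: U_u[OF p] U_x_zero[OF p] field_simps)
    have Utt: "Utt p = c3 / c1^2 * co_utt p"
      using contact_relations(2)[OF p contact_v_t] dd_T[OF p, of "v_t p"] dd_X[OF p, of "v_t p"] dUt[OF p, of "v_t p"] c
      by (simp add: T_t[OF p] v_t_def field_simps power2_eq_square)
    have Utx: "Utx p = c3 / (c1 * X_x p) * co_utx p"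
      using contact_relations(2)[OF p contact_v_x] dd_T[OF p, of "v_x p"] dd_X[OF p, of "v_x p"] dUt[OF p, of "v_x p"] c X_x
      by (simp add: v_x_def field_simps)
    have Uxx: "Uxx p = c3 / (X_x p)^2 * co_uxx p - c3 * X_xx p / (X_x p)^3 * co_ux p"
      using Uxx_relation[OF p] U_mixed_zero[OF p] X_x
      by (simp add: U_uu_zero[OF p] U_u[OF p] Ux field_simps power2_eq_square power3_eq_cube)
    have Ac: "Ac p = (X_x p)^2 / c1 * co_A p" and Bc: "Bc p = X_x p / c1 * co_B p + X_xx p / c1 * co_A p"
      using Ac_Bc[OF p] c by (simp_all add: T_t[OF p] field_simps)
    have "\<Phi> p = ((T p, X p, U p), (Ut p, Ux p, Utt p, Utx p, Uxx p), (Ac p, Bc p))"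
      by (simp add: comp_defs)
    moreover have "prolonged_transf c1 c2 c3 c4 h p = ((c1 * co_t p + c2, h (x_of p), c3 * co_u p + c4),
      (c3 / c1 * co_ut p, c3 / deriv h (x_of p) * co_ux p, c3 / c1^2 * co_utt p,
       c3 / (c1 * deriv h (x_of p)) * co_utx p,
       c3 / (deriv h (x_of p))^2 * co_uxx p - c3 * deriv (deriv h) (x_of p) / (deriv h (x_of p))^3 * co_ux p),
      ((deriv h (x_of p))^2 / c1 * co_A p, deriv h (x_of p) / c1 * co_B p + deriv (deriv h) (x_of p) / c1 * co_A p))"
      by (cases p) (auto simp: x_of_def base_of_def)
    ultimately show "\<Phi> p = prolonged_transf c1 c2 c3 c4 h p"
      unfolding h(2,3)[OF p] X_xx[OF p] by (simp only: T[OF p] U[OF p] Ut[OF p] Ux Utt Utx Uxx Ac Bc)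
  qed
qed

end

theorem proposition28:
  fixes D :: "espace set" and \<Phi> :: "espace \<Rightarrow> espace"
  shows "(D, \<Phi>) \<in> equivalence_pseudogroup \<longleftrightarrow>
    local_domain D \<and>
    (\<exists>(c1::real) (c2::real) (c3::real) (c4::real) (X :: real \<Rightarrow> real).
       c1 * c3 \<noteq> 0 \<and> smooth_on (x_of ` D) X \<and> (\<forall>x\<in>x_of ` D. deriv X x \<noteq> 0) \<and>
       (\<forall>t x u ut ux utt utx uxx A B.
          ((t, x, u), (ut, ux, utt, utx, uxx), (A, B)) \<in> D \<longrightarrow>
          \<Phi> ((t, x, u), (ut, ux, utt, utx, uxx), (A, B)) =
            ((c1 * t + c2, X x, c3 * u + c4),
             (c3 / c1 * ut,
              c3 / deriv X x * ux,
              c3 / c1^2 * utt,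
              c3 / (c1 * deriv X x) * utx,
              c3 / (deriv X x)^2 * uxx - c3 * deriv (deriv X) x / (deriv X x)^3 * ux),
             ((deriv X x)^2 / c1 * A,
              deriv X x / c1 * B + deriv (deriv X) x / c1 * A))))"
    (is "?L \<longleftrightarrow> local_domain D \<and> ?R")
proof
  assume L: ?L
  then have D: "local_domain D" by (simp add: equivalence_pseudogroup_def)
  have ?R
  proof (cases "D = {}")
    case True
    \<comment> \<open>An empty domain has no point at which to read off constants, and any
      admissible data serve: here constants 1 and the identity.\<close>
    have "smooth_on {} (\<lambda>x::real. x)" by (intro smooth_intros open_empty)
    then show ?thesis unfolding True by (intro exI[of _ 1] exI[of _ "\<lambda>x. x"]) simp
  next
    case False
    then obtain q where q: "q \<in> D" by blast
    interpret equiv_transf D \<Phi> by unfold_locales (fact L)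
    obtain c1 c2 c3 c4 h where *: "c1 * c3 \<noteq> 0" "smooth_on (x_of ` D) h" "\<forall>x\<in>x_of ` D. deriv h x \<noteq> 0"
      and eq: "\<And>p. p \<in> D \<Longrightarrow> \<Phi> p = prolonged_transf c1 c2 c3 c4 h p"
      by (rule is_prolonged_transf[OF q]) blast
    show ?thesis
      by (rule exI[of _ c1], rule exI[of _ c2], rule exI[of _ c3], rule exI[of _ c4], rule exI[of _ h],
          intro conjI allI impI *) (simp only: eq prolonged_transf.simps)
  qed
  with D show "local_domain D \<and> ?R" ..
next
  assume R: "local_domain D \<and> ?R"
  then obtain c1 c2 c3 c4 X where *: "c1 * c3 \<noteq> 0" "smooth_on (x_of ` D) X" "\<forall>x\<in>x_of ` D. deriv X x \<noteq> 0"
    and eq: "\<And>t x u ut ux utt utx uxx A B.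
          ((t, x, u), (ut, ux, utt, utx, uxx), (A, B)) \<in> D \<Longrightarrow>
          \<Phi> ((t, x, u), (ut, ux, utt, utx, uxx), (A, B)) =
            prolonged_transf c1 c2 c3 c4 X ((t, x, u), (ut, ux, utt, utx, uxx), (A, B))"
    unfolding prolonged_transf.simps by (elim conjE exE) blast
  interpret prolonged D c1 c2 c3 c4 X using R * by unfold_locales auto
  have "\<Phi> p = prolonged_transf c1 c2 c3 c4 X p" if "p \<in> D" for p
  proof -
    obtain t x u ut ux utt utx uxx A B where p: "p = ((t, x, u), (ut, ux, utt, utx, uxx), (A, B))"
      by (metis surj_pair)
    show ?thesis using that unfolding p by (rule eq)
  qed
  then show ?L using equivalence_pseudogroup_cong in_pseudogroup by blast
qed

end
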